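(* Let $T>0$, $\varepsilon>0$, and let $K_\varepsilon(w)=r_{[0,T]}(\eta_\varepsilon*w)$ for $w\in L^1(0,T)$. Then $K_\varepsilon:L^1(0,T)\to H^1(0,T)$ is a bounded linear operator. Moreover, if $j:H^1(0,T)\to\mathbb{R}$ is twice Fréchet differentiable and there is $C>0$ such that $$|\nabla^2 j(w)(\psi,\phi)|\le C\|\psi\|_{H^1(0,T)}\|\phi\|_{H^1(0,T)}\quad\text{for all } w,\psi,\phi\in H^1(0,T),$$ then $j_\varepsilon:=j\circ K_\varepsilon:L^2(0,T)\to\mathbb{R}$ is twice Fréchet differentiable and there is a constant $C_\varepsilon>0$ (depending on $\varepsilon$) such that $$|\nabla^2 j_\varepsilon(w)(\psi,\phi)|\le C_\varepsilon\|\psi\|_{L^1(0,T)}\|\phi\|_{L^1(0,T)}\quad\text{for all } w,\psi,\phi\in L^2(0,T).$$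
   Context: $(\eta_\varepsilon)_{\varepsilon>0}$ is a family of positive mollifiers: $\eta_\varepsilon(t)=\varepsilon^{-1}\eta(t/\varepsilon)$ with the usual kernel $\eta\in C_c^\infty(\mathbb{R})$, $\eta\ge 0$, $\int_{\mathbb{R}}\eta=1$, $\operatorname{supp}\eta\subset[-1,1]$. In $\eta_\varepsilon*w$ the function $w\in L^1(0,T)$ is extended by $0$ outside $[0,T]$; $r_{[0,T]}$ denotes restriction of a function on $\mathbb{R}$ to $[0,T]$. $\|f\|_{H^1(0,T)}^2=\|f\|_{L^2(0,T)}^2+\|f'\|_{L^2(0,T)}^2$. *)

theory Defs
  imports "HOL-Analysis.Analysis"
begin

text \<open>
  Since the interval length \<open>T\<close> is a term variable, the spaces over \<open>(0,T)\<close> cannot be types of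
  class \<open>real_normed_vector\<close>.  A normed space of functions modulo equality almost everywhere is
  given here by a carrier \<open>V\<close> of representatives and a seminorm \<open>N\<close> on it; two representatives
  stand for the same element if the seminorm of their difference is 0.  The values of a
  representative outside \<open>(0,T)\<close> do not matter.
\<close>

section \<open>Bounded linear maps and Frechet derivatives on seminormed function spaces\<close>

type_synonym rfun = "real \<Rightarrow> real"

text \<open>Linearity is required in the target space, that is, up to elements of seminorm 0.\<close>

definition bounded_linear_op ::
  "rfun set \<Rightarrow> (rfun \<Rightarrow> real) \<Rightarrow> rfun set \<Rightarrow> (rfun \<Rightarrow> real) \<Rightarrow> (rfun \<Rightarrow> rfun) \<Rightarrow> bool" where
  "bounded_linear_op V N W M A \<longleftrightarrow>
     (\<forall>u\<in>V. A u \<in> W) \<and>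
     (\<forall>u\<in>V. \<forall>v\<in>V. M (\<lambda>t. A (\<lambda>s. u s + v s) t - (A u t + A v t)) = 0) \<and>
     (\<forall>c. \<forall>u\<in>V. M (\<lambda>t. A (\<lambda>s. c * u s) t - c * A u t) = 0) \<and>
     (\<exists>B. \<forall>u\<in>V. M (A u) \<le> B * N u)"

definition bounded_linear_functional ::
  "rfun set \<Rightarrow> (rfun \<Rightarrow> real) \<Rightarrow> (rfun \<Rightarrow> real) \<Rightarrow> bool" where
  "bounded_linear_functional V N A \<longleftrightarrow>
     (\<forall>u\<in>V. \<forall>v\<in>V. A (\<lambda>s. u s + v s) = A u + A v) \<and>
     (\<forall>c. \<forall>u\<in>V. A (\<lambda>s. c * u s) = c * A u) \<and>
     (\<exists>B. \<forall>u\<in>V. \<bar>A u\<bar> \<le> B * N u)"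

definition bounded_bilinear_form ::
  "rfun set \<Rightarrow> (rfun \<Rightarrow> real) \<Rightarrow> (rfun \<Rightarrow> rfun \<Rightarrow> real) \<Rightarrow> bool" where
  "bounded_bilinear_form V N H \<longleftrightarrow>
     (\<forall>u\<in>V. bounded_linear_functional V N (\<lambda>v. H u v)) \<and>
     (\<forall>v\<in>V. bounded_linear_functional V N (\<lambda>u. H u v)) \<and>
     (\<exists>B. \<forall>u\<in>V. \<forall>v\<in>V. \<bar>H u v\<bar> \<le> B * N u * N v)"

definition has_frechet_derivative ::
  "rfun set \<Rightarrow> (rfun \<Rightarrow> real) \<Rightarrow> (rfun \<Rightarrow> real) \<Rightarrow> (rfun \<Rightarrow> real) \<Rightarrow> rfun \<Rightarrow> bool" where
  "has_frechet_derivative V N f A w \<longleftrightarrow>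
     bounded_linear_functional V N A \<and>
     (\<forall>e>0. \<exists>d>0. \<forall>h\<in>V. N h < d \<longrightarrow>
        \<bar>f (\<lambda>t. w t + h t) - f w - A h\<bar> \<le> e * N h)"

text \<open>
  Frechet differentiability of a map \<open>G\<close> from \<open>V\<close> to its dual space, with the derivative (a
  bounded linear map from \<open>V\<close> to its dual) written as a bilinear form.  The inequality quantified
  over \<open>k\<close> says that the dual norm of \<open>G (w + h) - G w - H h\<close> is at most \<open>e * N h\<close>.
\<close>

definition has_frechet_derivative_dual ::
  "rfun set \<Rightarrow> (rfun \<Rightarrow> real) \<Rightarrow> (rfun \<Rightarrow> rfun \<Rightarrow> real) \<Rightarrow> (rfun \<Rightarrow> rfun \<Rightarrow> real) \<Rightarrow> rfun \<Rightarrow> bool" where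
  "has_frechet_derivative_dual V N G H w \<longleftrightarrow>
     bounded_bilinear_form V N H \<and>
     (\<forall>e>0. \<exists>d>0. \<forall>h\<in>V. N h < d \<longrightarrow>
        (\<forall>k\<in>V. \<bar>G (\<lambda>t. w t + h t) k - G w k - H h k\<bar> \<le> e * N h * N k))"

text \<open>On the carrier \<open>V\<close>, both derivatives are unique where they exist.\<close>

definition grad :: "rfun set \<Rightarrow> (rfun \<Rightarrow> real) \<Rightarrow> (rfun \<Rightarrow> real) \<Rightarrow> rfun \<Rightarrow> rfun \<Rightarrow> real" where
  "grad V N f w = (SOME A. has_frechet_derivative V N f A w)"

definition hess ::
  "rfun set \<Rightarrow> (rfun \<Rightarrow> real) \<Rightarrow> (rfun \<Rightarrow> real) \<Rightarrow> rfun \<Rightarrow> rfun \<Rightarrow> rfun \<Rightarrow> real" where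
  "hess V N f w = (SOME H. has_frechet_derivative_dual V N (grad V N f) H w)"

definition twice_frechet_differentiable ::
  "rfun set \<Rightarrow> (rfun \<Rightarrow> real) \<Rightarrow> (rfun \<Rightarrow> real) \<Rightarrow> bool" where
  "twice_frechet_differentiable V N f \<longleftrightarrow>
     (\<forall>w\<in>V. \<exists>A. has_frechet_derivative V N f A w) \<and>
     (\<forall>w\<in>V. \<exists>H. has_frechet_derivative_dual V N (grad V N f) H w)"

text \<open>
  A differentiable functional is well defined on equivalence classes, so no separate
  compatibility assumption on functionals of representatives is needed.
\<close>

lemma has_frechet_derivative_respects:
  assumes "has_frechet_derivative V N f A w" "h \<in> V" "N h = 0"
  shows "f (\<lambda>t. w t + h t) = f w"
proof -
  have "\<exists>B. \<forall>u\<in>V. \<bar>A u\<bar> \<le> B * N u"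
    using assms(1) unfolding has_frechet_derivative_def bounded_linear_functional_def by blast
  then obtain B where "\<bar>A h\<bar> \<le> B * N h" using assms(2) by blast
  hence A: "A h = 0" using assms(3) by simp
  have "\<forall>e>0. \<exists>d>0. \<forall>h\<in>V. N h < d \<longrightarrow> \<bar>f (\<lambda>t. w t + h t) - f w - A h\<bar> \<le> e * N h"
    using assms(1) unfolding has_frechet_derivative_def by blast
  then obtain d :: real where "d > 0"
    "\<forall>h\<in>V. N h < d \<longrightarrow> \<bar>f (\<lambda>t. w t + h t) - f w - A h\<bar> \<le> 1 * N h"
    using zero_less_one by blast
  hence "\<bar>f (\<lambda>t. w t + h t) - f w - A h\<bar> \<le> 1 * N h" using assms(2,3) by (metis)
  thus ?thesis using A assms(3) by simp
qed

section \<open>The spaces L1, L2 and H1 on the interval\<close>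

definition L1_space :: "real \<Rightarrow> rfun set" where
  "L1_space T = {w. integrable (lebesgue_on {0<..<T}) w}"

definition L1_norm :: "real \<Rightarrow> rfun \<Rightarrow> real" where
  "L1_norm T w = (LINT t|lebesgue_on {0<..<T}. \<bar>w t\<bar>)"

definition L2_space :: "real \<Rightarrow> rfun set" where
  "L2_space T = {w \<in> borel_measurable (lebesgue_on {0<..<T}).
                   integrable (lebesgue_on {0<..<T}) (\<lambda>t. (w t)\<^sup>2)}"

definition L2_norm :: "real \<Rightarrow> rfun \<Rightarrow> real" where
  "L2_norm T w = sqrt (LINT t|lebesgue_on {0<..<T}. (w t)\<^sup>2)"

definition smooth :: "rfun \<Rightarrow> bool" where
  "smooth f \<longleftrightarrow> (\<forall>n x. ((deriv ^^ n) f) differentiable (at x))"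

definition supp :: "rfun \<Rightarrow> real set" where
  "supp f = closure {x. f x \<noteq> 0}"

definition test_function :: "real \<Rightarrow> rfun \<Rightarrow> bool" where
  "test_function T \<phi> \<longleftrightarrow> smooth \<phi> \<and> compact (supp \<phi>) \<and> supp \<phi> \<subseteq> {0<..<T}"

definition has_weak_deriv :: "real \<Rightarrow> rfun \<Rightarrow> rfun \<Rightarrow> bool" where
  "has_weak_deriv T u v \<longleftrightarrow>
     (\<forall>\<phi>. test_function T \<phi> \<longrightarrow>
        (LINT t|lebesgue_on {0<..<T}. u t * deriv \<phi> t)
          = - (LINT t|lebesgue_on {0<..<T}. v t * \<phi> t))"

definition H1_space :: "real \<Rightarrow> rfun set" where
  "H1_space T = {u \<in> L2_space T. \<exists>v\<in>L2_space T. has_weak_deriv T u v}"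

text \<open>The weak derivative is unique up to equality almost everywhere on \<open>(0,T)\<close>.\<close>

definition weak_deriv :: "real \<Rightarrow> rfun \<Rightarrow> rfun" where
  "weak_deriv T u = (SOME v. v \<in> L2_space T \<and> has_weak_deriv T u v)"

definition H1_norm :: "real \<Rightarrow> rfun \<Rightarrow> real" where
  "H1_norm T u = sqrt ((L2_norm T u)\<^sup>2 + (L2_norm T (weak_deriv T u))\<^sup>2)"

section \<open>Mollification\<close>

definition mollifier_kernel :: "rfun \<Rightarrow> bool" where
  "mollifier_kernel \<eta> \<longleftrightarrow>
     smooth \<eta> \<and> (\<forall>t. \<eta> t \<ge> 0) \<and> supp \<eta> \<subseteq> {-1..1} \<and> (LINT t|lebesgue. \<eta> t) = 1"

definition mollifier :: "rfun \<Rightarrow> real \<Rightarrow> rfun" where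
  "mollifier \<eta> \<epsilon> t = \<eta> (t / \<epsilon>) / \<epsilon>"

definition convolve :: "rfun \<Rightarrow> rfun \<Rightarrow> rfun" where
  "convolve f g t = (LINT s|lebesgue. f (t - s) * g s)"

text \<open>
  With functions on \<open>[0,T]\<close> represented by functions on the line, the same truncation serves as
  the extension by 0 and as the restriction to \<open>[0,T]\<close>.
\<close>

definition cut :: "real \<Rightarrow> rfun \<Rightarrow> rfun" where
  "cut T f t = (if t \<in> {0..T} then f t else 0)"

definition K_op :: "rfun \<Rightarrow> real \<Rightarrow> real \<Rightarrow> rfun \<Rightarrow> rfun" where
  "K_op \<eta> \<epsilon> T w = cut T (convolve (mollifier \<eta> \<epsilon>) (cut T w))"

end

theory Submission
  imports Defs
begin

text \<open>
  With \<open>g = \<eta>\<^sub>\<epsilon>\<close>, the function \<open>g * w\<close> has the classical derivative \<open>g' * w\<close>, and both are bounded by a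
  constant times the \<open>L\<^sup>1\<close> norm of \<open>w\<close>.  On a bounded interval this bounds the \<open>H\<^sup>1\<close> norm, once the
  classical derivative is known to be the weak derivative almost everywhere.  That uniqueness holds
  because a function orthogonal to all test functions has integral 0 over every \<open>(a,T)\<close>, so its
  positive and negative parts are densities of the same measure.  The second claim is then the
  chain rule for a linear inner map: the Hessian of \<open>j \<circ> K\<close> at \<open>w\<close> is
  \<open>(\<psi>,\<phi>) \<mapsto> \<nabla>\<^sup>2 j (K w) (K \<psi>, K \<phi>)\<close>.
\<close>

text \<open>\<open>grad\<close> and \<open>hess\<close> are chosen by \<open>SOME\<close>, so
  exhibiting a derivative of \<open>j \<circ> K\<close> says nothing about them until derivatives
  are known to be unique, and uniqueness is available only for arguments in the carrier. Since
  \<open>hess\<close> differentiates the chosen \<open>grad\<close>, the gradient has to be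
  identified before the Hessian. The same obstacle returns in \<open>H1_norm\<close>, which is built
  on a chosen \<open>weak_deriv\<close>: even the norm of the zero function has to be computed
  through uniqueness. Two bounds for K are in play. Differentiability on L2 uses the bound from L2
  to H1, which costs a factor sqrt T; the Hessian estimate uses the bound from L1 to H1 and
  therefore ends with L1 norms. The latter constant is B = sqrt T * (b + b'), where b and b' bound
  the mollifier and its derivative, and the Hessian constant is C * B * B. The test functions behind
  uniqueness come from the kernel itself, whose primitive is a smooth step.\<close>

section \<open>The chain rule for a bounded linear inner map\<close>

lemma homogeneous_little_o_eq_0:
  fixes D :: "rfun \<Rightarrow> real"
  assumes scale: "\<And>c u. u \<in> V \<Longrightarrow> (\<lambda>s. c * u s) \<in> V"
    and norm_scale: "\<And>c u. u \<in> V \<Longrightarrow> N (\<lambda>s. c * u s) = \<bar>c\<bar> * N u"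
    and nonneg: "\<And>u. 0 \<le> N u"
    and D_scale: "\<And>c u. u \<in> V \<Longrightarrow> D (\<lambda>s. c * u s) = c * D u"
    and small: "\<And>e. e > 0 \<Longrightarrow> \<exists>d>0. \<forall>h\<in>V. N h < d \<longrightarrow> \<bar>D h\<bar> \<le> e * N h * P"
    and u: "u \<in> V"
  shows "D u = 0"
proof -
  have bound: "\<bar>D u\<bar> \<le> e * (N u * P)" if "e > 0" for e
  proof -
    obtain d where d: "d > 0" "\<And>h. h \<in> V \<Longrightarrow> N h < d \<Longrightarrow> \<bar>D h\<bar> \<le> e * N h * P"
      using small[OF \<open>e > 0\<close>] by blast
    \<comment> \<open>This scale gives N (c * u) < d; the added 1 keeps the quotient meaningful when
      N u = 0.\<close>
    define c where "c = d / (N u + 1)"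
    have N1: "N u + 1 > 0" using nonneg[of u] by simp
    have c: "c > 0" using d(1) N1 by (simp add: c_def)
    have "N (\<lambda>s. c * u s) = c * N u" using norm_scale[OF u, of c] c by simp
    moreover have "c * N u < d"
      using d(1) N1 by (simp add: c_def field_simps)
    ultimately have "\<bar>c * D u\<bar> \<le> e * (c * N u) * P"
      using d(2)[OF scale[OF u, of c]] D_scale[OF u, of c] by simp
    hence "c * \<bar>D u\<bar> \<le> c * (e * (N u * P))"
      using c by (simp add: abs_mult mult_ac)
    thus ?thesis using c by simp
  qed
  have "\<bar>D u\<bar> \<le> 0"
  proof (rule field_le_epsilon)
    fix e :: real assume e: "e > 0"
    \<comment> \<open>N u * P may be zero or negative, whereas \<open>?X\<close> is positive and
      dominates it, so the choice e / ?X leaves exactly e.\<close>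
    let ?X = "\<bar>N u * P\<bar> + 1"
    have "\<bar>D u\<bar> \<le> e / ?X * (N u * P)" using bound[of "e / ?X"] e by simp
    also have "\<dots> \<le> e / ?X * ?X" using e by (intro mult_left_mono) auto
    also have "\<dots> = e" by (simp add: add_nonneg_eq_0_iff)
    finally show "\<bar>D u\<bar> \<le> 0 + e" by simp
  qed
  thus ?thesis by simp
qed

lemma has_frechet_derivativeD:
  assumes "has_frechet_derivative V N f A w" "e > 0"
  obtains d where "d > 0"
    "\<And>h. h \<in> V \<Longrightarrow> N h < d \<Longrightarrow> \<bar>f (\<lambda>t. w t + h t) - f w - A h\<bar> \<le> e * N h"
  using assms unfolding has_frechet_derivative_def by blast

lemma has_frechet_derivative_dualD:
  assumes "has_frechet_derivative_dual V N G H w" "e > 0"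
  obtains d where "d > 0"
    "\<And>h k. h \<in> V \<Longrightarrow> N h < d \<Longrightarrow> k \<in> V \<Longrightarrow>
       \<bar>G (\<lambda>t. w t + h t) k - G w k - H h k\<bar> \<le> e * N h * N k"
  using assms unfolding has_frechet_derivative_dual_def by blast

text \<open>The difference of two derivatives is linear, and by the triangle inequality with e/2 for
  each it is o(N h), hence it vanishes. Nothing is claimed for directions outside V, where the
  choice in \<open>grad\<close> is unconstrained.\<close>

lemma has_frechet_derivative_unique:
  assumes scale: "\<And>c u. u \<in> V \<Longrightarrow> (\<lambda>s. c * u s) \<in> V"
    and norm_scale: "\<And>c u. u \<in> V \<Longrightarrow> N (\<lambda>s. c * u s) = \<bar>c\<bar> * N u"
    and nonneg: "\<And>u. 0 \<le> N u"
    and A: "has_frechet_derivative V N f A w" and B: "has_frechet_derivative V N f B w"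
    and u: "u \<in> V"
  shows "A u = B u"
proof -
  have "(\<lambda>u. A u - B u) u = 0"
  proof (rule homogeneous_little_o_eq_0[of V N "\<lambda>u. A u - B u" 1, OF scale norm_scale nonneg])
    show "A (\<lambda>s. c * u s) - B (\<lambda>s. c * u s) = c * (A u - B u)" if "u \<in> V" for c u
      using A B that
      by (simp add: has_frechet_derivative_def bounded_linear_functional_def right_diff_distrib)
    show "\<exists>d>0. \<forall>h\<in>V. N h < d \<longrightarrow> \<bar>A h - B h\<bar> \<le> e * N h * 1" if e: "e > 0" for e
    proof -
      obtain d1 where d1: "d1 > 0"
        "\<And>h. h \<in> V \<Longrightarrow> N h < d1 \<Longrightarrow> \<bar>f (\<lambda>t. w t + h t) - f w - A h\<bar> \<le> (e/2) * N h"
        by (rule has_frechet_derivativeD[OF A, of "e/2"]) (use e in auto)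
      obtain d2 where d2: "d2 > 0"
        "\<And>h. h \<in> V \<Longrightarrow> N h < d2 \<Longrightarrow> \<bar>f (\<lambda>t. w t + h t) - f w - B h\<bar> \<le> (e/2) * N h"
        by (rule has_frechet_derivativeD[OF B, of "e/2"]) (use e in auto)
      have "\<bar>A h - B h\<bar> \<le> e * N h * 1" if "h \<in> V" "N h < min d1 d2" for h
        using d1(2)[of h] d2(2)[of h] that by (simp, linarith)
      thus ?thesis using d1(1) d2(1) by (intro exI[of _ "min d1 d2"]) auto
    qed
  qed (use u in auto)
  thus ?thesis by simp
qed

text \<open>With v frozen, the dual estimate is an estimate for a linear map in u alone, and N v
  becomes a constant factor.\<close>

lemma has_frechet_derivative_dual_unique:
  assumes scale: "\<And>c u. u \<in> V \<Longrightarrow> (\<lambda>s. c * u s) \<in> V"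
    and norm_scale: "\<And>c u. u \<in> V \<Longrightarrow> N (\<lambda>s. c * u s) = \<bar>c\<bar> * N u"
    and nonneg: "\<And>u. 0 \<le> N u"
    and A: "has_frechet_derivative_dual V N G A w" and B: "has_frechet_derivative_dual V N G B w"
    and u: "u \<in> V" and v: "v \<in> V"
  shows "A u v = B u v"
proof -
  have "(\<lambda>u. A u v - B u v) u = 0"
  proof (rule homogeneous_little_o_eq_0[of V N "\<lambda>u. A u v - B u v" "N v",
        OF scale norm_scale nonneg])
    show "A (\<lambda>s. c * u s) v - B (\<lambda>s. c * u s) v = c * (A u v - B u v)" if "u \<in> V" for c u
      using A B that v
      by (simp add: has_frechet_derivative_dual_def bounded_bilinear_form_def
          bounded_linear_functional_def right_diff_distrib)
    show "\<exists>d>0. \<forall>h\<in>V. N h < d \<longrightarrow> \<bar>A h v - B h v\<bar> \<le> e * N h * N v" if e: "e > 0" for e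
    proof -
      obtain d1 where d1: "d1 > 0"
        "\<And>h k. h \<in> V \<Longrightarrow> N h < d1 \<Longrightarrow> k \<in> V \<Longrightarrow>
           \<bar>G (\<lambda>t. w t + h t) k - G w k - A h k\<bar> \<le> (e/2) * N h * N k"
        by (rule has_frechet_derivative_dualD[OF A, of "e/2"]) (use e in auto)
      obtain d2 where d2: "d2 > 0"
        "\<And>h k. h \<in> V \<Longrightarrow> N h < d2 \<Longrightarrow> k \<in> V \<Longrightarrow>
           \<bar>G (\<lambda>t. w t + h t) k - G w k - B h k\<bar> \<le> (e/2) * N h * N k"
        by (rule has_frechet_derivative_dualD[OF B, of "e/2"]) (use e in auto)
      have "\<bar>A h v - B h v\<bar> \<le> e * N h * N v" if "h \<in> V" "N h < min d1 d2" for h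
        using d1(2)[of h v] d2(2)[of h v] that v by (simp, linarith)
      thus ?thesis using d1(1) d2(1) by (intro exI[of _ "min d1 d2"]) auto
    qed
  qed (use u in auto)
  thus ?thesis by simp
qed

section \<open>Derivatives of a composition with a bounded linear map\<close>

lemma bounded_linear_functional_compose:
  assumes maps: "\<And>u. u \<in> V \<Longrightarrow> K u \<in> W"
    and add: "\<And>u v. u \<in> V \<Longrightarrow> v \<in> V \<Longrightarrow> K (\<lambda>s. u s + v s) = (\<lambda>s. K u s + K v s)"
    and homog: "\<And>c u. u \<in> V \<Longrightarrow> K (\<lambda>s. c * u s) = (\<lambda>s. c * K u s)"
    and bound: "\<And>u. u \<in> V \<Longrightarrow> M (K u) \<le> B * N u"
    and M: "\<And>u. 0 \<le> M u"
    and A: "bounded_linear_functional W M A"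
  shows "bounded_linear_functional V N (\<lambda>u. A (K u))"
proof -
  obtain C where C: "\<And>u. u \<in> W \<Longrightarrow> \<bar>A u\<bar> \<le> C * M u"
    using A unfolding bounded_linear_functional_def by blast
  \<comment> \<open>The constant C from the definition need not be nonnegative; |C| makes the
    multiplication monotone.\<close>
  have "\<bar>A (K u)\<bar> \<le> \<bar>C\<bar> * B * N u" if "u \<in> V" for u
  proof -
    have "\<bar>A (K u)\<bar> \<le> C * M (K u)" by (rule C[OF maps[OF that]])
    also have "\<dots> \<le> \<bar>C\<bar> * M (K u)" using M by (intro mult_right_mono) auto
    also have "\<dots> \<le> \<bar>C\<bar> * (B * N u)" using bound[OF that] by (intro mult_left_mono) auto
    finally show ?thesis by (simp add: mult_ac)
  qed
  thus ?thesis
    using A maps unfolding bounded_linear_functional_def by (auto simp: add homog)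
qed

text \<open>K (w + h) equals K w + K h exactly, so the remainder of f \<circ> K for the increment h
  is the remainder of f at K w for the increment K h. Since K enlarges seminorms by at most B, the
  tolerance is taken as e / B and the radius as d / B.\<close>

lemma frechet_derivative_compose_linear:
  assumes maps: "\<And>u. u \<in> V \<Longrightarrow> K u \<in> W"
    and add: "\<And>u v. u \<in> V \<Longrightarrow> v \<in> V \<Longrightarrow> K (\<lambda>s. u s + v s) = (\<lambda>s. K u s + K v s)"
    and homog: "\<And>c u. u \<in> V \<Longrightarrow> K (\<lambda>s. c * u s) = (\<lambda>s. c * K u s)"
    and B: "0 < B" and bound: "\<And>u. u \<in> V \<Longrightarrow> M (K u) \<le> B * N u"
    and M: "\<And>u. 0 \<le> M u"
    and w: "w \<in> V" and A: "has_frechet_derivative W M f A (K w)"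
  shows "has_frechet_derivative V N (f \<circ> K) (\<lambda>u. A (K u)) w"
  unfolding has_frechet_derivative_def
proof (intro conjI allI impI)
  show "bounded_linear_functional V N (\<lambda>u. A (K u))"
    using A unfolding has_frechet_derivative_def
    by (intro bounded_linear_functional_compose[where V=V and K=K and W=W and B=B and M=M and N=N,
          OF maps add homog bound M]) auto
  fix e :: real assume e: "e > 0"
  obtain d where d: "d > 0"
    "\<And>h. h \<in> W \<Longrightarrow> M h < d \<Longrightarrow> \<bar>f (\<lambda>t. K w t + h t) - f (K w) - A h\<bar> \<le> e / B * M h"
    by (rule has_frechet_derivativeD[OF A, of "e / B"]) (use e B in auto)
  have "\<bar>(f \<circ> K) (\<lambda>t. w t + h t) - (f \<circ> K) w - A (K h)\<bar> \<le> e * N h"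
    if h: "h \<in> V" "N h < d / B" for h
  proof -
    have "M (K h) < d"
      using bound[OF h(1)] h(2) B by (simp add: field_simps)
    hence "\<bar>f (\<lambda>t. K w t + K h t) - f (K w) - A (K h)\<bar> \<le> e / B * M (K h)"
      using d(2) maps[OF h(1)] by blast
    also have "\<dots> \<le> e / B * (B * N h)"
      using bound[OF h(1)] e B by (intro mult_left_mono) auto
    finally show ?thesis using B by (simp add: add[OF w h(1)])
  qed
  thus "\<exists>d>0. \<forall>h\<in>V. N h < d \<longrightarrow>
      \<bar>(f \<circ> K) (\<lambda>t. w t + h t) - (f \<circ> K) w - A (K h)\<bar> \<le> e * N h"
    using d(1) B by (intro exI[of _ "d / B"]) auto
qed

text \<open>Here K acts on the increment and on the test direction, whence the tolerance e / (B *
  B). The map G' is kept abstract because the gradient of f \<circ> K agrees with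
  \<open>G (K u) (K k)\<close> only for u and k in V; \<open>plus\<close> ensures that this
  agreement may be used at w + h.\<close>

lemma frechet_derivative_dual_compose_linear:
  assumes maps: "\<And>u. u \<in> V \<Longrightarrow> K u \<in> W"
    and add: "\<And>u v. u \<in> V \<Longrightarrow> v \<in> V \<Longrightarrow> K (\<lambda>s. u s + v s) = (\<lambda>s. K u s + K v s)"
    and homog: "\<And>c u. u \<in> V \<Longrightarrow> K (\<lambda>s. c * u s) = (\<lambda>s. c * K u s)"
    and B: "0 < B" and bound: "\<And>u. u \<in> V \<Longrightarrow> M (K u) \<le> B * N u"
    and M: "\<And>u. 0 \<le> M u"
    and plus: "\<And>u v. u \<in> V \<Longrightarrow> v \<in> V \<Longrightarrow> (\<lambda>s. u s + v s) \<in> V"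
    and G': "\<And>u k. u \<in> V \<Longrightarrow> k \<in> V \<Longrightarrow> G' u k = G (K u) (K k)"
    and w: "w \<in> V" and H: "has_frechet_derivative_dual W M G H (K w)"
  shows "has_frechet_derivative_dual V N G' (\<lambda>u v. H (K u) (K v)) w"
  unfolding has_frechet_derivative_dual_def
proof (intro conjI allI impI)
  have HW: "bounded_bilinear_form W M H"
    using H by (simp add: has_frechet_derivative_dual_def)
  then obtain C where C: "\<And>u v. u \<in> W \<Longrightarrow> v \<in> W \<Longrightarrow> \<bar>H u v\<bar> \<le> C * M u * M v"
    unfolding bounded_bilinear_form_def by blast
  have "\<bar>H (K u) (K v)\<bar> \<le> (\<bar>C\<bar> * B * B) * N u * N v" if u: "u \<in> V" "v \<in> V" for u v
  proof -
    have "\<bar>H (K u) (K v)\<bar> \<le> C * M (K u) * M (K v)" using C maps u by blast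
    also have "\<dots> \<le> \<bar>C\<bar> * M (K u) * M (K v)" using M by (intro mult_right_mono) auto
    also have "\<dots> \<le> \<bar>C\<bar> * (B * N u) * (B * N v)"
    proof (intro mult_mono bound u order_refl)
      show "0 \<le> \<bar>C\<bar> * (B * N u)" using order_trans[OF M bound[OF u(1)]] by simp
    qed (use M in auto)
    finally show ?thesis by (simp add: mult_ac)
  qed
  moreover have "bounded_linear_functional V N (\<lambda>u. A (K u))"
    if "bounded_linear_functional W M A" for A
    by (rule bounded_linear_functional_compose[where V=V and K=K and W=W and B=B and M=M and N=N,
          OF maps add homog bound M that])
  ultimately show "bounded_bilinear_form V N (\<lambda>u v. H (K u) (K v))"
    using HW maps unfolding bounded_bilinear_form_def by blast
  fix e :: real assume e: "e > 0"
  obtain d where d: "d > 0"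
    "\<And>h k. h \<in> W \<Longrightarrow> M h < d \<Longrightarrow> k \<in> W \<Longrightarrow>
       \<bar>G (\<lambda>t. K w t + h t) k - G (K w) k - H h k\<bar> \<le> e / (B * B) * M h * M k"
    by (rule has_frechet_derivative_dualD[OF H, of "e / (B * B)"]) (use e B in auto)
  have "\<bar>G' (\<lambda>t. w t + h t) k - G' w k - H (K h) (K k)\<bar> \<le> e * N h * N k"
    if h: "h \<in> V" "N h < d / B" "k \<in> V" for h k
  proof -
    have "M (K h) < d"
      using bound[OF h(1)] h(2) B by (simp add: field_simps)
    hence "\<bar>G (\<lambda>t. K w t + K h t) (K k) - G (K w) (K k) - H (K h) (K k)\<bar>
        \<le> e / (B * B) * M (K h) * M (K k)"
      using d(2) maps h by blast
    also have "\<dots> \<le> e / (B * B) * (B * N h) * (B * N k)"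
    proof (intro mult_mono bound h order_refl)
      show "0 \<le> e / (B * B) * (B * N h)" using order_trans[OF M bound[OF h(1)]] e B
        by (intro mult_nonneg_nonneg) (auto simp: zero_le_mult_iff)
    qed (use M e B in auto)
    finally show ?thesis using B h w by (simp add: G' plus add)
  qed
  thus "\<exists>d>0. \<forall>h\<in>V. N h < d \<longrightarrow>
      (\<forall>k\<in>V. \<bar>G' (\<lambda>t. w t + h t) k - G' w k - H (K h) (K k)\<bar> \<le> e * N h * N k)"
    using d(1) B by (intro exI[of _ "d / B"]) auto
qed

lemma grad_has_frechet_derivative:
  "has_frechet_derivative V N f A w \<Longrightarrow> has_frechet_derivative V N f (grad V N f w) w"
  unfolding grad_def by (rule someI[of "\<lambda>A. has_frechet_derivative V N f A w"])

lemma hess_has_frechet_derivative: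
  "has_frechet_derivative_dual V N (grad V N f) H w \<Longrightarrow>
    has_frechet_derivative_dual V N (grad V N f) (hess V N f w) w"
  unfolding hess_def by (rule someI[of "\<lambda>H. has_frechet_derivative_dual V N (grad V N f) H w"])

text \<open>The first-order chain rule and uniqueness give \<open>grad_eq\<close>; this is the
  hypothesis on G' in the second-order chain rule, whose result is a derivative of the chosen
  gradient. Uniqueness then identifies \<open>hess\<close>.\<close>

lemma twice_frechet_differentiable_compose_linear:
  assumes maps: "\<And>u. u \<in> V \<Longrightarrow> K u \<in> W"
    and add: "\<And>u v. u \<in> V \<Longrightarrow> v \<in> V \<Longrightarrow> K (\<lambda>s. u s + v s) = (\<lambda>s. K u s + K v s)"
    and homog: "\<And>c u. u \<in> V \<Longrightarrow> K (\<lambda>s. c * u s) = (\<lambda>s. c * K u s)"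
    and B: "0 < B" and bound: "\<And>u. u \<in> V \<Longrightarrow> M (K u) \<le> B * N u"
    and M: "\<And>u. 0 \<le> M u"
    and plus: "\<And>u v. u \<in> V \<Longrightarrow> v \<in> V \<Longrightarrow> (\<lambda>s. u s + v s) \<in> V"
    and scale: "\<And>c u. u \<in> V \<Longrightarrow> (\<lambda>s. c * u s) \<in> V"
    and norm_scale: "\<And>c u. u \<in> V \<Longrightarrow> N (\<lambda>s. c * u s) = \<bar>c\<bar> * N u"
    and nonneg: "\<And>u. 0 \<le> N u"
    and f: "twice_frechet_differentiable W M f"
  shows "twice_frechet_differentiable V N (f \<circ> K)"
    and "\<And>w u v. w \<in> V \<Longrightarrow> u \<in> V \<Longrightarrow> v \<in> V \<Longrightarrow>
      hess V N (f \<circ> K) w u v = hess W M f (K w) (K u) (K v)"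
proof -
  have grad_f: "has_frechet_derivative W M f (grad W M f w) w" if "w \<in> W" for w
    using f that grad_has_frechet_derivative unfolding twice_frechet_differentiable_def by blast
  have hess_f: "has_frechet_derivative_dual W M (grad W M f) (hess W M f w) w" if "w \<in> W" for w
    using f that hess_has_frechet_derivative unfolding twice_frechet_differentiable_def by blast
  have first: "has_frechet_derivative V N (f \<circ> K) (\<lambda>u. grad W M f (K w) (K u)) w"
    if "w \<in> V" for w
    by (rule frechet_derivative_compose_linear[where V=V and K=K and W=W and B=B and M=M and N=N
          and A="grad W M f (K w)", OF maps add homog B bound M that grad_f[OF maps[OF that]]])
  have grad_eq: "grad V N (f \<circ> K) w u = grad W M f (K w) (K u)" if "w \<in> V" "u \<in> V" for w u
  proof (rule has_frechet_derivative_unique[where V=V and N=N,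
        OF scale norm_scale nonneg _ first[OF that(1)] that(2)])
    show "has_frechet_derivative V N (f \<circ> K) (grad V N (f \<circ> K) w) w"
      by (rule grad_has_frechet_derivative[OF first[OF that(1)]])
  qed
  have second: "has_frechet_derivative_dual V N (grad V N (f \<circ> K))
      (\<lambda>u v. hess W M f (K w) (K u) (K v)) w" if "w \<in> V" for w
    by (rule frechet_derivative_dual_compose_linear[where V=V and K=K and W=W and B=B and M=M and N=N
          and G="grad W M f" and G'="grad V N (f \<circ> K)" and H="hess W M f (K w)",
          OF maps add homog B bound M plus grad_eq that hess_f[OF maps[OF that]]])
  show "twice_frechet_differentiable V N (f \<circ> K)"
    using first second unfolding twice_frechet_differentiable_def by blast
  show "hess V N (f \<circ> K) w u v = hess W M f (K w) (K u) (K v)"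
    if "w \<in> V" "u \<in> V" "v \<in> V" for w u v
  proof (rule has_frechet_derivative_dual_unique[where V=V and N=N,
        OF scale norm_scale nonneg _ second[OF that(1)]])
    show "has_frechet_derivative_dual V N (grad V N (f \<circ> K)) (hess V N (f \<circ> K) w) w"
      by (rule hess_has_frechet_derivative[OF second[OF that(1)]])
  qed (use that in auto)
qed

section \<open>Smooth functions\<close>

lemma smooth_has_derivative: "smooth f \<Longrightarrow> (f has_real_derivative deriv f x) (at x)"
  unfolding smooth_def
  by (metis DERIV_deriv_iff_real_differentiable funpow_0)

lemma smooth_deriv: "smooth f \<Longrightarrow> smooth (deriv f)"
  unfolding smooth_def by (metis comp_apply funpow_Suc_right)

lemma smooth_continuous_on: "smooth f \<Longrightarrow> continuous_on S f"
  by (meson DERIV_continuous_on has_field_derivative_at_within smooth_has_derivative)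

lemma smooth_borel_measurable: "smooth f \<Longrightarrow> f \<in> borel_measurable borel"
  by (rule borel_measurable_continuous_onI) (rule smooth_continuous_on)

text \<open>Used to see that a primitive of the kernel is smooth: each higher derivative of f is a
  derivative of g of one order less.\<close>

lemma smooth_of_derivative:
  assumes "\<And>x. (f has_real_derivative g x) (at x)" "smooth g"
  shows "smooth f"
  unfolding smooth_def
proof (intro allI)
  fix n x
  have g: "deriv f = g" using assms(1) by (auto intro: DERIV_imp_deriv)
  show "(deriv ^^ n) f differentiable at x"
  proof (cases n)
    case 0
    thus ?thesis using assms(1) by (auto simp: real_differentiable_def)
  next
    case (Suc m)
    thus ?thesis using assms(2) g by (simp add: funpow_Suc_right smooth_def del: funpow.simps)
  qed
qed

lemma smooth_diff:
  assumes "smooth f" "smooth g"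
  shows "smooth (\<lambda>x. f x - g x)"
proof -
  have "(deriv ^^ n) (\<lambda>x. f x - g x) differentiable at x" for n x
    using assms
  proof (induction n arbitrary: f g)
    case 0
    thus ?case
      by (auto simp: real_differentiable_def intro!: derivative_eq_intros smooth_has_derivative)
  next
    case (Suc n)
    have "deriv (\<lambda>x. f x - g x) = (\<lambda>x. deriv f x - deriv g x)"
      using Suc.prems by (intro ext DERIV_imp_deriv DERIV_diff smooth_has_derivative)
    thus ?case
      using Suc.IH[of "deriv f" "deriv g"] Suc.prems smooth_deriv
      by (simp add: funpow_Suc_right del: funpow.simps)
  qed
  thus ?thesis by (simp add: smooth_def)
qed

text \<open>The shape a * f (c * x + d) is preserved by differentiation, with a * c and
  \<open>deriv f\<close> in place of a and f; the induction must therefore leave both free.\<close>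

lemma smooth_affine:
  assumes "smooth f"
  shows "smooth (\<lambda>x. a * f (c * x + d))"
proof -
  have "(deriv ^^ n) (\<lambda>x. a * f (c * x + d)) differentiable at x" for n x
    using assms
  proof (induction n arbitrary: f a)
    case (0 f a)
    have "((\<lambda>x. a * f (c * x + d)) has_real_derivative a * (deriv f (c * x + d) * c)) (at x)"
      by (rule DERIV_cmult, rule DERIV_chain2[OF smooth_has_derivative[OF 0]])
         (auto intro!: derivative_eq_intros)
    thus ?case by (auto simp: real_differentiable_def)
  next
    case (Suc n f a)
    have "((\<lambda>x. a * f (c * x + d)) has_real_derivative a * (deriv f (c * x + d) * c)) (at x)" for x
      by (rule DERIV_cmult, rule DERIV_chain2[OF smooth_has_derivative[OF Suc.prems]])
         (auto intro!: derivative_eq_intros)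
    hence "deriv (\<lambda>x. a * f (c * x + d)) = (\<lambda>x. (a * c) * deriv f (c * x + d))"
      by (intro ext DERIV_imp_deriv) (simp add: mult_ac)
    thus ?case
      using Suc.IH[of "deriv f" "a * c"] Suc.prems smooth_deriv
      by (simp add: funpow_Suc_right del: funpow.simps)
  qed
  thus ?thesis by (simp add: smooth_def)
qed

text \<open>The set |x| > R is open, so f is zero near x. This passes the support bound on to
  derivatives, to which \<open>smooth_bounded\<close> is then applied.\<close>

lemma deriv_eq_0_outside:
  fixes f :: "real \<Rightarrow> real"
  assumes "\<And>x. R < \<bar>x\<bar> \<Longrightarrow> f x = 0" "R < \<bar>x\<bar>"
  shows "deriv f x = 0"
proof (rule DERIV_imp_deriv)
  have "open {x::real. R < \<bar>x\<bar>}" by (intro open_Collect_less continuous_intros)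
  moreover have "((\<lambda>x. 0) has_real_derivative 0) (at x)" by simp
  ultimately show "(f has_real_derivative 0) (at x)"
    using assms by (elim has_field_derivative_transform_within_open) auto
qed

lemma smooth_bounded:
  assumes "smooth f" "\<And>x. R < \<bar>x\<bar> \<Longrightarrow> f x = 0"
  obtains B where "B > 0" "\<And>x. \<bar>f x\<bar> \<le> B"
proof -
  have "compact (f ` {-R..R})"
    by (intro compact_continuous_image smooth_continuous_on assms compact_Icc)
  then obtain B where B: "B > 0" "\<And>y. y \<in> f ` {-R..R} \<Longrightarrow> \<bar>y\<bar> \<le> B"
    by (metis bounded_pos compact_imp_bounded real_norm_def)
  have "\<bar>f x\<bar> \<le> B" for x
    
  proof (cases "R < \<bar>x\<bar>")
    case False
    hence "f x \<in> f ` {-R..R}" by (intro imageI) auto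
    thus ?thesis by (rule B(2))
  qed (use B(1) assms(2)[of x] in simp)
  thus thesis using B(1) that by blast
qed

text \<open>The mean value inequality is used twice: for f', giving a Lipschitz constant B, and then
  for f y - y * f' x on the ball of radius |h|, whose derivative is at most B * |h|. The bound is
  uniform in x, which lets it be integrated against w.\<close>

lemma first_order_remainder_bound:
  fixes f f' f'' :: "real \<Rightarrow> real"
  assumes f: "\<And>x. (f has_real_derivative f' x) (at x)"
    and f': "\<And>x. (f' has_real_derivative f'' x) (at x)"
    and B: "\<And>x. \<bar>f'' x\<bar> \<le> B"
  shows "\<bar>f (x + h) - f x - h * f' x\<bar> \<le> B * h\<^sup>2"
proof -
  have lip: "\<bar>f' y - f' x\<bar> \<le> B * \<bar>h\<bar>" if "\<bar>y - x\<bar> \<le> \<bar>h\<bar>" for y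
  proof -
    have "B \<ge> 0" using B[of 0] by simp
    have "norm (f' y - f' x) \<le> B * norm (y - x)"
      by (rule field_differentiable_bound[of UNIV f' f'']) (use f' B in auto)
    also have "\<dots> \<le> B * \<bar>h\<bar>" using that \<open>B \<ge> 0\<close> by (intro mult_left_mono) auto
    finally show ?thesis by simp
  qed
  have "norm ((\<lambda>y. f y - y * f' x) (x + h) - (\<lambda>y. f y - y * f' x) x)
      \<le> (B * \<bar>h\<bar>) * norm (x + h - x)"
  proof (rule field_differentiable_bound[of "cball x \<bar>h\<bar>" _ "\<lambda>y. f' y - f' x"])
    fix y assume "y \<in> cball x \<bar>h\<bar>"
    hence "\<bar>y - x\<bar> \<le> \<bar>h\<bar>" by (simp add: dist_real_def abs_minus_commute)
    thus "norm (f' y - f' x) \<le> B * \<bar>h\<bar>" using lip by simp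
    show "((\<lambda>y. f y - y * f' x) has_real_derivative f' y - f' x) (at y within cball x \<bar>h\<bar>)"
      by (rule has_field_derivative_at_within) (auto intro!: derivative_eq_intros f)
  qed (auto simp: dist_real_def)
  thus ?thesis by (simp add: algebra_simps power2_eq_square)
qed

section \<open>Lebesgue spaces on the interval\<close>

lemma lebesgue_on_finite_measure: "finite_measure (lebesgue_on {0<..<T::real})"
  by (rule finite_measure_lebesgue_on) (use lmeasurable_box[of 0 T] in simp)

lemma measure_lebesgue_on_interval:
  "T > 0 \<Longrightarrow> measure (lebesgue_on {0<..<T::real}) (space (lebesgue_on {0<..<T})) = T"
  by (subst measure_restrict_space) auto

lemma borel_measurable_lebesgue_on: "f \<in> borel_measurable borel \<Longrightarrow> f \<in> borel_measurable (lebesgue_on S)"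
  for f :: "real \<Rightarrow> real"
  by (intro measurable_restrict_space1 measurable_completion) simp

lemma integrable_lebesgue_on_iff:
  "integrable (lebesgue_on {0<..<T::real}) f \<longleftrightarrow> integrable lebesgue (\<lambda>t. indicator {0<..<T} t * f t)"
  for f :: rfun
  by (simp add: integrable_restrict_space)

lemma integral_lebesgue_on_eq:
  "(LINT t|lebesgue_on {0<..<T::real}. f t) = (LINT t|lebesgue. indicator {0<..<T} t * f t)"
  for f :: rfun
  by (simp add: integral_restrict_space)

lemma L2_norm_nonneg: "0 \<le> L2_norm T u"
  by (simp add: L2_norm_def)

lemma L2_norm_scale: "L2_norm T (\<lambda>s. c * u s) = \<bar>c\<bar> * L2_norm T u"
  by (simp add: L2_norm_def power_mult_distrib real_sqrt_mult)

lemma L2_space_scale: "u \<in> L2_space T \<Longrightarrow> (\<lambda>s. c * u s) \<in> L2_space T"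
proof -
  assume u: "u \<in> L2_space T"
  hence [measurable]: "u \<in> borel_measurable (lebesgue_on {0<..<T})" by (simp add: L2_space_def)
  have "(\<lambda>s. c * u s) \<in> borel_measurable (lebesgue_on {0<..<T})" by measurable
  thus ?thesis using u by (simp add: L2_space_def power_mult_distrib)
qed

lemma L2_space_add:
  assumes "u \<in> L2_space T" "v \<in> L2_space T"
  shows "(\<lambda>s. u s + v s) \<in> L2_space T"
proof -
  have [measurable]: "u \<in> borel_measurable (lebesgue_on {0<..<T})"
    "v \<in> borel_measurable (lebesgue_on {0<..<T})"
    using assms by (auto simp: L2_space_def)
  have "integrable (lebesgue_on {0<..<T}) (\<lambda>t. (u t + v t)\<^sup>2)"
  proof (rule Bochner_Integration.integrable_bound)
    show "integrable (lebesgue_on {0<..<T}) (\<lambda>t. 2 * (u t)\<^sup>2 + 2 * (v t)\<^sup>2)"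
      using assms by (auto simp: L2_space_def)
    have "(u t + v t)\<^sup>2 \<le> 2 * (u t)\<^sup>2 + 2 * (v t)\<^sup>2" for t
      using sum_squares_bound[of "u t" "v t"] by (simp add: power2_sum)
    thus "AE t in lebesgue_on {0<..<T}. norm ((u t + v t)\<^sup>2) \<le> norm (2 * (u t)\<^sup>2 + 2 * (v t)\<^sup>2)"
      by simp
  qed simp
  thus ?thesis by (simp add: L2_space_def)
qed

text \<open>On a space of finite measure the function 1 + u^2 is integrable, and it dominates
  |u|.\<close>

lemma L2_space_subset_L1_space: "L2_space T \<subseteq> L1_space T"
proof
  fix u assume u: "u \<in> L2_space T"
  interpret finite_measure "lebesgue_on {0<..<T}" by (rule lebesgue_on_finite_measure)
  have "integrable (lebesgue_on {0<..<T}) u"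
  proof (rule Bochner_Integration.integrable_bound)
    show "integrable (lebesgue_on {0<..<T}) (\<lambda>t. 1 + (u t)\<^sup>2)"
      using u by (auto simp: L2_space_def)
    have "\<bar>x\<bar> \<le> 1 + x\<^sup>2" for x :: real
      using sum_squares_bound[of 1 "\<bar>x\<bar>"] by simp
    thus "AE t in lebesgue_on {0<..<T}. norm (u t) \<le> norm (1 + (u t)\<^sup>2)"
      by (simp add: add_nonneg_nonneg)
  qed (use u in \<open>simp add: L2_space_def\<close>)
  thus "u \<in> L1_space T" by (simp add: L1_space_def)
qed

text \<open>Cauchy-Schwarz against the constant 1, obtained here from the nonnegativity of the
  integral of (|u| - m)^2 with m the mean value of |u|.\<close>

lemma L1_norm_le_L2_norm:
  assumes T: "T > 0" and u: "u \<in> L2_space T"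
  shows "L1_norm T u \<le> sqrt T * L2_norm T u"
proof -
  let ?M = "lebesgue_on {0<..<T}"
  interpret finite_measure ?M by (rule lebesgue_on_finite_measure)
  define m where "m = L1_norm T u / T"
  have int: "integrable ?M (\<lambda>t. \<bar>u t\<bar>)" "integrable ?M (\<lambda>t. (u t)\<^sup>2)"
    using u L2_space_subset_L1_space by (auto simp: L1_space_def L2_space_def)
  have "0 \<le> (LINT t|?M. (\<bar>u t\<bar> - m)\<^sup>2)" by simp
  also have "\<dots> = (LINT t|?M. (u t)\<^sup>2 - 2 * m * \<bar>u t\<bar> + m\<^sup>2)"
    by (intro Bochner_Integration.integral_cong) (simp_all add: power2_diff algebra_simps)
  also have "\<dots> = (LINT t|?M. (u t)\<^sup>2) - 2 * m * L1_norm T u + T * m\<^sup>2"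
    using int T measure_lebesgue_on_interval[OF T] by (simp add: L1_norm_def)
  finally have "(L1_norm T u)\<^sup>2 \<le> T * (LINT t|?M. (u t)\<^sup>2)"
    using T by (simp add: m_def power2_eq_square field_simps)
  hence "sqrt ((L1_norm T u)\<^sup>2) \<le> sqrt (T * (LINT t|?M. (u t)\<^sup>2))" by (rule real_sqrt_le_mono)
  thus ?thesis by (simp add: L2_norm_def real_sqrt_mult L1_norm_def)
qed

text \<open>Separating u from F serves the truncated convolution: \<open>K_op\<close> may jump at
  the endpoints, while inside the interval it equals a continuous function on the line.\<close>

lemma bounded_mem_L2_space:
  assumes T: "T > 0" and F: "F \<in> borel_measurable borel" and b: "\<And>t. \<bar>F t\<bar> \<le> b"
    and u: "\<And>t. t \<in> {0<..<T} \<Longrightarrow> u t = F t"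
  shows "u \<in> L2_space T" and "L2_norm T u \<le> sqrt T * b"
proof -
  let ?M = "lebesgue_on {0<..<T}"
  interpret finite_measure ?M by (rule lebesgue_on_finite_measure)
  have [measurable]: "F \<in> borel_measurable ?M" by (rule borel_measurable_lebesgue_on[OF F])
  have b0: "b \<ge> 0" using b[of 0] by simp
  have sq: "(F t)\<^sup>2 \<le> b\<^sup>2" for t using b[of t] by (metis abs_le_square_iff abs_of_nonneg b0)
  have int: "integrable ?M (\<lambda>t. (F t)\<^sup>2)"
    by (rule integrable_const_bound[where B="b\<^sup>2"]) (use sq in auto)
  have "u \<in> borel_measurable ?M \<longleftrightarrow> F \<in> borel_measurable ?M"
    by (rule measurable_cong) (use u in simp)
  moreover have "integrable ?M (\<lambda>t. (u t)\<^sup>2) \<longleftrightarrow> integrable ?M (\<lambda>t. (F t)\<^sup>2)"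
    by (rule Bochner_Integration.integrable_cong) (use u in auto)
  ultimately show "u \<in> L2_space T" using int by (simp add: L2_space_def)
  have "(LINT t|?M. (u t)\<^sup>2) = (LINT t|?M. (F t)\<^sup>2)"
    by (rule Bochner_Integration.integral_cong) (use u in auto)
  also have "\<dots> \<le> (LINT t|?M. b\<^sup>2)" by (rule integral_mono) (use int sq in auto)
  also have "\<dots> = T * b\<^sup>2" using measure_lebesgue_on_interval[OF T] by simp
  finally have "sqrt (LINT t|?M. (u t)\<^sup>2) \<le> sqrt (T * b\<^sup>2)" by (rule real_sqrt_le_mono)
  thus "L2_norm T u \<le> sqrt T * b" using b0 by (simp add: L2_norm_def real_sqrt_mult)
qed

section \<open>Uniqueness of weak derivatives\<close>

text \<open>Half-lines generate the Borel sets and are closed under intersection, so two measures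
  that are finite and equal on them coincide. Uniqueness of densities then compares the
  integrands.\<close>

lemma AE_eq_0_of_tail_integrals_lborel:
  fixes f :: "real \<Rightarrow> real"
  assumes f: "integrable lborel f"
    and tails: "\<And>x. (LINT t|lborel. indicator {x<..} t * f t) = 0"
  shows "AE t in lborel. f t = 0"
proof -
  have [measurable]: "f \<in> borel_measurable borel" using f by auto
  have int: "integrable lborel (\<lambda>t. indicator {x<..} t * max 0 (g t))"
    if "integrable lborel g" for g :: "real \<Rightarrow> real" and x
    using integrable_mult_indicator[of "{x<..}" lborel "\<lambda>t. max 0 (g t)"] that by simp
  have em: "emeasure (density lborel (\<lambda>t. ennreal (g t))) {x<..}
      = ennreal (LINT t|lborel. indicator {x<..} t * max 0 (g t))"
    if "integrable lborel g" for g :: "real \<Rightarrow> real" and x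
  proof -
    have [measurable]: "g \<in> borel_measurable borel" using that by auto
    have "emeasure (density lborel (\<lambda>t. ennreal (g t))) {x<..}
        = (\<integral>\<^sup>+t. ennreal (g t) * indicator {x<..} t \<partial>lborel)"
      by (rule emeasure_density) auto
    also have "\<dots> = (\<integral>\<^sup>+t. ennreal (indicator {x<..} t * max 0 (g t)) \<partial>lborel)"
      by (intro nn_integral_cong) (auto simp: indicator_def max_def ennreal_neg)
    also have "\<dots> = ennreal (LINT t|lborel. indicator {x<..} t * max 0 (g t))"
      by (rule nn_integral_eq_integral[OF int[OF that]]) auto
    finally show ?thesis .
  qed
  \<comment> \<open>\<open>ennreal\<close> sends negative values to 0, so these are the densities
    given by the positive and the negative part of f. Equal parts at a point force f to vanish
    there.\<close>
  have "density lborel (\<lambda>t. ennreal (f t)) = density lborel (\<lambda>t. ennreal (- f t))"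
  proof (rule measure_eqI_lessThan)
    fix x
    show "emeasure (density lborel (\<lambda>t. ennreal (f t))) {x<..} < \<infinity>"
      using em[OF f] by simp
    have "0 = (LINT t|lborel. indicator {x<..} t * f t)" by (simp only: tails)
    also have "\<dots> = (LINT t|lborel. indicator {x<..} t * max 0 (f t) - indicator {x<..} t * max 0 (- f t))"
      by (intro Bochner_Integration.integral_cong) (auto simp: indicator_def)
    also have "\<dots> = (LINT t|lborel. indicator {x<..} t * max 0 (f t))
        - (LINT t|lborel. indicator {x<..} t * max 0 (- f t))"
      using int[OF f, of x] int[of "\<lambda>t. - f t" x] f
      by (intro Bochner_Integration.integral_diff) auto
    finally show "emeasure (density lborel (\<lambda>t. ennreal (f t))) {x<..}
        = emeasure (density lborel (\<lambda>t. ennreal (- f t))) {x<..}"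
      using em[OF f, of x] em[of "\<lambda>t. - f t" x] f by simp
  qed auto
  hence "AE t in lborel. ennreal (f t) = ennreal (- f t)"
    by (intro sigma_finite_measure.density_unique[OF sigma_finite_lborel]) auto
  thus ?thesis
  proof eventually_elim
    case (elim t)
    thus ?case by (cases "f t \<ge> 0") (auto simp: ennreal_neg)
  qed
qed

text \<open>The comparison of measures lives on Borel sets, so f is replaced by a Borel function
  that equals it almost everywhere.\<close>

lemma AE_eq_0_of_tail_integrals:
  fixes f :: "real \<Rightarrow> real"
  assumes f: "integrable lebesgue f"
    and tails: "\<And>x. (LINT t|lebesgue. indicator {x<..} t * f t) = 0"
  shows "AE t in lebesgue. f t = 0"
proof -
  obtain g where [measurable]: "g \<in> borel_measurable lborel" and fg: "AE t in lborel. f t = g t"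
    using completion_ex_borel_measurable_real[of f lborel] f by auto
  have [measurable]: "f \<in> borel_measurable lebesgue" using f by auto
  have g_leb [measurable]: "g \<in> borel_measurable lebesgue" by (simp add: measurable_completion)
  have fg': "AE t in lebesgue. f t = g t" by (rule AE_completion[OF fg])
  have "integrable lebesgue g"
    using f fg' by (subst integrable_cong_AE[symmetric, of f]) auto
  hence "integrable lborel g" by (simp add: integrable_completion)
  moreover have "(LINT t|lborel. indicator {x<..} t * g t) = 0" for x
  proof -
    have "(LINT t|lborel. indicator {x<..} t * g t) = (LINT t|lebesgue. indicator {x<..} t * g t)"
      by (rule integral_completion[symmetric]) auto
    also have "\<dots> = (LINT t|lebesgue. indicator {x<..} t * f t)"
      using fg' by (intro integral_cong_AE borel_measurable_times borel_measurable_indicator g_leb) auto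
    finally show ?thesis by (simp add: tails)
  qed
  ultimately have "AE t in lborel. g t = 0" by (rule AE_eq_0_of_tail_integrals_lborel)
  with fg have "AE t in lborel. f t = 0" by eventually_elim simp
  thus ?thesis by (rule AE_completion)
qed

section \<open>Smooth steps and test functions approximating an indicator\<close>

lemma eq_0_outside_supp: "supp f \<subseteq> S \<Longrightarrow> x \<notin> S \<Longrightarrow> f x = 0"
  unfolding supp_def using closure_subset[of "{x. f x \<noteq> 0}"] by blast

text \<open>The step is the primitive of the kernel: it increases because the kernel is nonnegative
  and ends at 1 because the kernel has mass 1.\<close>

lemma smooth_step_exists:
  assumes "mollifier_kernel \<eta>"
  obtains H where "smooth H" "\<And>x. 0 \<le> H x" "\<And>x. H x \<le> 1"
    "\<And>x. x \<le> -1 \<Longrightarrow> H x = 0" "\<And>x. 1 \<le> x \<Longrightarrow> H x = 1"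
proof -
  have smooth: "smooth \<eta>" and nonneg: "\<And>t. \<eta> t \<ge> 0"
    and one: "(LINT t|lebesgue. \<eta> t) = 1" and out: "\<And>t. t \<notin> {-1..1} \<Longrightarrow> \<eta> t = 0"
    using assms eq_0_outside_supp[of \<eta> "{-1..1}"] by (auto simp: mollifier_kernel_def)
  \<comment> \<open>Starting at -2, strictly left of the support, makes every x \<ge> -1 an interior
    point of {-2..x+1}, so the derivative there is two-sided; further left H is locally 0.\<close>
  define H where "H x = integral {-2..x} \<eta>" for x
  have H_low: "H x = 0" if "x \<le> -1" for x
  proof -
    have "integral {-2..x} \<eta> = integral {-2..x} (\<lambda>_. 0)"
    \<comment> \<open>\<open>out\<close> says nothing about the value at -1, so this single point is
      discarded as negligible.\<close>
    proof (rule integral_spike[of "{-1}"])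
      show "0 = \<eta> t" if "t \<in> {-2..x} - {-1}" for t
        using that \<open>x \<le> -1\<close> out[of t] by auto
    qed auto
    thus ?thesis by (simp add: H_def)
  qed
  have deriv: "(H has_real_derivative \<eta> x) (at x)" for x
  proof (cases "x < -1")
    case True
    have "((\<lambda>x. 0) has_real_derivative 0) (at x)" by simp
    hence "(H has_real_derivative 0) (at x)"
      by (rule has_field_derivative_transform_within_open[of _ _ _ "{..< -1}"])
         (use True H_low in auto)
    thus ?thesis using out[of x] True by simp
  next
    case False
    have "(H has_real_derivative \<eta> x) (at x within {-2..x+1})"
      unfolding H_def using False
      by (intro integral_has_real_derivative smooth_continuous_on[OF smooth]) auto
    moreover have "at x within {-2..x+1} = at x" using False by (intro at_within_Icc_at) auto
    ultimately show ?thesis by simp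
  qed
  have H_high: "H x = 1" if "1 \<le> x" for x
  proof -
    \<comment> \<open>The integral of a function that is not integrable is 0 by default, and here it
      is 1.\<close>
    have int: "integrable lebesgue \<eta>"
      using one not_integrable_integral_eq[of lebesgue \<eta>] by (metis zero_neq_one)
    have "(\<eta> has_integral H x) {-2..x}"
      unfolding H_def
      by (intro integrable_integral integrable_continuous_real smooth_continuous_on[OF smooth])
    hence "(\<eta> has_integral H x) UNIV"
      by (rule has_integral_on_superset) (use out that in auto)
    moreover have "(\<eta> has_integral 1) UNIV"
      using has_integral_integral_lebesgue[OF int] one by simp
    ultimately show ?thesis by (rule has_integral_unique)
  qed
  have mono: "H x \<le> H y" if "x \<le> y" for x y
    using DERIV_nonneg_imp_nondecreasing[OF that] deriv nonneg by blast
  show thesis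
  proof (rule that)
    show "smooth H" by (rule smooth_of_derivative[OF deriv smooth])
    show "0 \<le> H x" for x using mono[of "min x (-1)" x] H_low[of "min x (-1)"] by simp
    show "H x \<le> 1" for x using mono[of x "max x 1"] H_high[of "max x 1"] by simp
  qed (use H_low H_high in auto)
qed

text \<open>
  Differences of two steepening smooth steps, the first moved to the right of \<open>a\<close> and the second
  to the left of \<open>T\<close>, are test functions whose pointwise limit is the indicator of \<open>(a,T)\<close>.
\<close>

lemma test_functions_tendsto_indicator:
  assumes \<eta>: "mollifier_kernel \<eta>" and a: "0 \<le> a" "a < T"
  obtains \<phi> :: "nat \<Rightarrow> rfun" where "\<And>n. test_function T (\<phi> n)" "\<And>n t. \<bar>\<phi> n t\<bar> \<le> 1"
    "\<And>t. (\<lambda>n. \<phi> n t) \<longlonglongrightarrow> indicator {a<..<T} t"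
proof -
  obtain H where H: "smooth H" "\<And>x. 0 \<le> H x" "\<And>x. H x \<le> 1"
    "\<And>x. x \<le> -1 \<Longrightarrow> H x = 0" "\<And>x. 1 \<le> x \<Longrightarrow> H x = 1"
    using smooth_step_exists[OF \<eta>] by blast
  \<comment> \<open>The two steps rise on [a + 1/c, a + 3/c] and [T - 3/c, T - 1/c]. Since c * (T -
    a) \<ge> 6, the second rise does not begin before the first has ended.\<close>
  define c where "c n = 6 * real (Suc n) / (T - a)" for n
  have c: "c n > 0" and cT: "c n * (T - a) = 6 * real (Suc n)" for n
    using a by (auto simp: c_def)
  define \<phi> where "\<phi> n t = H (c n * (t - a) - 2) - H (c n * (t - T) + 2)" for n t
  have args: "c n * (t - T) = c n * (t - a) - 6 * real (Suc n)" for n t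
    unfolding cT[symmetric] by (simp add: algebra_simps)
  have out: "\<phi> n t = 0" if "t \<notin> {a + 1 / c n..T - 1 / c n}" for n t
  proof (cases "t < a + 1 / c n")
    case True
    hence "c n * (t - a) < 1" using c[of n] by (simp add: field_simps)
    thus ?thesis using H(4) args[of n t] by (simp add: \<phi>_def)
  next
    case False
    hence "t > T - 1 / c n" using that by auto
    hence "c n * (t - T) > -1" using c[of n] by (simp add: field_simps)
    thus ?thesis using H(5) args[of n t] by (simp add: \<phi>_def)
  qed
  show thesis
  proof (rule that)
    fix n
    have c1: "1 / c n > 0" using c[of n] by simp
    have supp: "supp (\<phi> n) \<subseteq> {a + 1 / c n..T - 1 / c n}"
      unfolding supp_def
    proof (rule closure_minimal)
      show "{t. \<phi> n t \<noteq> 0} \<subseteq> {a + 1 / c n..T - 1 / c n}" using out by blast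
    qed simp
    hence "bounded (supp (\<phi> n))" by (rule bounded_subset[OF bounded_closed_interval])
    hence "compact (supp (\<phi> n))" by (simp add: compact_eq_bounded_closed supp_def)
    moreover have "supp (\<phi> n) \<subseteq> {0<..<T}"
    proof
      fix t assume "t \<in> supp (\<phi> n)"
      hence "a + 1 / c n \<le> t" "t \<le> T - 1 / c n" using supp by auto
      hence "0 < t" "t < T" using c1 a by linarith+
      thus "t \<in> {0<..<T}" by simp
    qed
    moreover have "smooth (\<phi> n)"
    proof -
      have eq: "\<phi> n = (\<lambda>t. 1 * H (c n * t + (- c n * a - 2)) - 1 * H (c n * t + (2 - c n * T)))"
        by (simp add: \<phi>_def fun_eq_iff algebra_simps)
      show ?thesis unfolding eq by (rule smooth_diff; rule smooth_affine[OF H(1)])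
    qed
    ultimately show "test_function T (\<phi> n)" by (simp add: test_function_def)
    show "\<bar>\<phi> n t\<bar> \<le> 1" for t
      using H(2,3)[of "c n * (t - a) - 2"] H(2,3)[of "c n * (t - T) + 2"]
      unfolding \<phi>_def abs_le_iff by linarith
  next
    fix t
    \<comment> \<open>Once c * (t - a) and c * (T - t) reach 3, the arguments of H are at least 1
      and at most -1, so the difference of the steps is exactly 1.\<close>
    have lim: "eventually (\<lambda>n. 3 \<le> c n * y) sequentially" if "y > 0" for y
    proof -
      have "eventually (\<lambda>n. (T - a) / y \<le> real n) sequentially"
        using filterlim_real_sequentially by (simp add: filterlim_at_top)
      thus ?thesis
      proof eventually_elim
        case (elim n)
        hence "T - a \<le> real n * y" using that by (simp add: field_simps)
        hence "3 * (T - a) \<le> 6 * real (Suc n) * y" using that a by (simp add: algebra_simps)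
        thus ?case using a by (simp add: c_def field_simps)
      qed
    qed
    show "(\<lambda>n. \<phi> n t) \<longlonglongrightarrow> indicator {a<..<T} t"
    proof (cases "t \<in> {a<..<T}")
      case True
      have "eventually (\<lambda>n. 3 \<le> c n * (t - a)) sequentially"
        "eventually (\<lambda>n. 3 \<le> c n * (T - t)) sequentially"
        using True by (simp_all add: lim)
      hence "eventually (\<lambda>n. \<phi> n t = 1) sequentially"
      proof eventually_elim
        case (elim n)
        have "c n * (t - T) = - (c n * (T - t))" by (simp add: algebra_simps)
        thus ?case using elim True H(4,5) by (simp add: \<phi>_def)
      qed
      thus ?thesis using True by (simp add: tendsto_eventually)
    next
      case False
      have "\<phi> n t = 0" for n
      proof (rule out)
        have "1 / c n > 0" using c[of n] by simp
        moreover have "t \<le> a \<or> T \<le> t" using False by auto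
        ultimately have "\<not> a + 1 / c n \<le> t \<or> \<not> t \<le> T - 1 / c n" by linarith
        thus "t \<notin> {a + 1 / c n..T - 1 / c n}" by auto
      qed
      thus ?thesis using False by simp
    qed
  qed
qed

section \<open>Weak derivatives: uniqueness and comparison with classical derivatives\<close>

lemma integrable_mult_bounded:
  fixes v \<phi> :: rfun
  assumes v: "integrable (lebesgue_on {0<..<T}) v" and \<phi>: "\<phi> \<in> borel_measurable borel" "\<And>t. \<bar>\<phi> t\<bar> \<le> b"
  shows "integrable (lebesgue_on {0<..<T}) (\<lambda>t. v t * \<phi> t)"
proof (rule Bochner_Integration.integrable_bound[where f="\<lambda>t. b * v t"])
  show "integrable (lebesgue_on {0<..<T}) (\<lambda>t. b * v t)" using v by simp
  show "(\<lambda>t. v t * \<phi> t) \<in> borel_measurable (lebesgue_on {0<..<T})"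
    using v by (intro borel_measurable_times borel_measurable_lebesgue_on[OF \<phi>(1)]) simp
  have "\<bar>v t * \<phi> t\<bar> \<le> \<bar>b * v t\<bar>" for t
    using mult_left_mono[OF \<phi>(2)[of t], of "\<bar>v t\<bar>"] \<phi>(2)[of t] by (simp add: abs_mult mult.commute)
  thus "AE t in lebesgue_on {0<..<T}. norm (v t * \<phi> t) \<le> norm (b * v t)" by simp
qed

lemma test_function_bounded:
  assumes "test_function T \<phi>"
  obtains b where "\<And>t. \<bar>\<phi> t\<bar> \<le> b"
proof (rule smooth_bounded)
  show "smooth \<phi>" using assms by (simp add: test_function_def)
  show "\<phi> t = 0" if "\<bar>T\<bar> < \<bar>t\<bar>" for t
  proof (rule eq_0_outside_supp[of \<phi> "{0<..<T}"])
    show "t \<notin> {0<..<T}" using that by auto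
  qed (use assms in \<open>simp add: test_function_def\<close>)
qed (use that in blast)

text \<open>The fundamental lemma of the calculus of variations. Test functions converging to an
  indicator are bounded by 1, so |v| is a majorant and the vanishing integrals pass to the
  limit.\<close>

lemma AE_eq_0_of_test_functions:
  assumes \<eta>: "mollifier_kernel \<eta>" and T: "T > 0"
    and v: "integrable (lebesgue_on {0<..<T}) v"
    and zero: "\<And>\<phi>. test_function T \<phi> \<Longrightarrow> (LINT t|lebesgue_on {0<..<T}. v t * \<phi> t) = 0"
  shows "AE t in lebesgue_on {0<..<T}. v t = 0"
proof -
  let ?M = "lebesgue_on {0<..<T}"
  have [measurable]: "v \<in> borel_measurable ?M" using v by simp
  have Ioo: "(LINT t|?M. v t * indicator {a<..<T} t) = 0" if a: "0 \<le> a" "a < T" for a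
  proof -
    obtain \<phi> where \<phi>: "\<And>n. test_function T (\<phi> n)" "\<And>n t. \<bar>\<phi> n t\<bar> \<le> 1"
      "\<And>t. (\<lambda>n. \<phi> n t) \<longlonglongrightarrow> indicator {a<..<T} t"
      using test_functions_tendsto_indicator[OF \<eta> a] by blast
    have [measurable]: "\<phi> n \<in> borel_measurable ?M" for n
      using \<phi>(1)[of n]
      by (intro borel_measurable_lebesgue_on smooth_borel_measurable) (simp add: test_function_def)
    have [measurable]: "(indicator {a<..<T} :: rfun) \<in> borel_measurable ?M" for a :: real
      by (rule borel_measurable_lebesgue_on) simp
    have "(\<lambda>n. LINT t|?M. v t * \<phi> n t) \<longlonglongrightarrow> (LINT t|?M. v t * indicator {a<..<T} t)"
    proof (rule integral_dominated_convergence[where w="\<lambda>t. \<bar>v t\<bar>"])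
      show "AE t in ?M. norm (v t * \<phi> n t) \<le> \<bar>v t\<bar>" for n
        using mult_left_mono[OF \<phi>(2)[of n], of "\<bar>v _\<bar>"] by (intro AE_I2) (simp add: abs_mult)
      show "AE t in ?M. (\<lambda>n. v t * \<phi> n t) \<longlonglongrightarrow> v t * indicator {a<..<T} t"
        by (intro AE_I2 tendsto_mult tendsto_const \<phi>(3))
    qed (use v in simp_all)
    moreover have "(\<lambda>n. LINT t|?M. v t * \<phi> n t) = (\<lambda>n. 0)" using zero[OF \<phi>(1)] by simp
    ultimately show ?thesis using LIMSEQ_unique tendsto_const by metis
  qed
  \<comment> \<open>Extended by 0, v has as its tail integral from x the integral over (max x 0, T),
    or 0 if x \<ge> T.\<close>
  have "AE t in lebesgue. indicator {0<..<T} t * v t = 0"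
  proof (rule AE_eq_0_of_tail_integrals)
    show "integrable lebesgue (\<lambda>t. indicator {0<..<T} t * v t)"
      using v by (simp add: integrable_lebesgue_on_iff)
    fix x
    show "(LINT t|lebesgue. indicator {x<..} t * (indicator {0<..<T} t * v t)) = 0"
    proof (cases "x < T")
      case True
      have "(LINT t|lebesgue. indicator {x<..} t * (indicator {0<..<T} t * v t))
          = (LINT t|lebesgue. indicator {0<..<T} t * (v t * indicator {max x 0<..<T} t))"
        by (intro Bochner_Integration.integral_cong) (auto simp: indicator_def)
      also have "\<dots> = (LINT t|?M. v t * indicator {max x 0<..<T} t)"
        by (rule integral_lebesgue_on_eq[symmetric])
      also have "\<dots> = 0" by (rule Ioo) (use True T in auto)
      finally show ?thesis .
    next
      case False
      hence "(\<lambda>t. indicator {x<..} t * (indicator {0<..<T} t * v t)) = (\<lambda>t. 0)"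
        by (auto simp: indicator_def)
      thus ?thesis by simp
    qed
  qed
  hence "AE t in lebesgue. t \<in> {0<..<T} \<longrightarrow> v t = 0"
    by eventually_elim (auto simp: indicator_def)
  thus ?thesis by (subst AE_restrict_space_iff) auto
qed

lemma weak_deriv_unique:
  assumes \<eta>: "mollifier_kernel \<eta>" and T: "T > 0"
    and v: "v \<in> L2_space T" "has_weak_deriv T u v"
    and w: "w \<in> L2_space T" "has_weak_deriv T u w"
  shows "AE t in lebesgue_on {0<..<T}. v t = w t"
proof -
  have int: "integrable (lebesgue_on {0<..<T}) v" "integrable (lebesgue_on {0<..<T}) w"
    using v w L2_space_subset_L1_space by (auto simp: L1_space_def)
  have "AE t in lebesgue_on {0<..<T}. v t - w t = 0"
  proof (rule AE_eq_0_of_test_functions[OF \<eta> T])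
    show "integrable (lebesgue_on {0<..<T}) (\<lambda>t. v t - w t)" using int by simp
    fix \<phi> assume \<phi>: "test_function T \<phi>"
    obtain b where b: "\<And>t. \<bar>\<phi> t\<bar> \<le> b" using test_function_bounded[OF \<phi>] by blast
    have meas: "\<phi> \<in> borel_measurable borel"
      using \<phi> by (intro smooth_borel_measurable) (simp add: test_function_def)
    have "(LINT t|lebesgue_on {0<..<T}. u t * deriv \<phi> t) = - (LINT t|lebesgue_on {0<..<T}. v t * \<phi> t)"
      "(LINT t|lebesgue_on {0<..<T}. u t * deriv \<phi> t) = - (LINT t|lebesgue_on {0<..<T}. w t * \<phi> t)"
      using v(2) w(2) \<phi> unfolding has_weak_deriv_def by blast+
    thus "(LINT t|lebesgue_on {0<..<T}. (v t - w t) * \<phi> t) = 0"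
      using integrable_mult_bounded[OF int(1) meas b]
        integrable_mult_bounded[OF int(2) meas b]
      by (simp add: left_diff_distrib)
  qed
  thus ?thesis by simp
qed

text \<open>Allows \<open>H1_norm\<close> to be computed with any concrete weak derivative in place
  of the chosen one.\<close>

lemma weak_deriv_L2_norm:
  assumes \<eta>: "mollifier_kernel \<eta>" and T: "T > 0"
    and v: "v \<in> L2_space T" "has_weak_deriv T u v"
  shows "L2_norm T (weak_deriv T u) = L2_norm T v"
proof -
  have w: "weak_deriv T u \<in> L2_space T \<and> has_weak_deriv T u (weak_deriv T u)"
    unfolding weak_deriv_def by (rule someI[of _ v]) (use v in simp)
  hence "AE t in lebesgue_on {0<..<T}. weak_deriv T u t = v t"
    using weak_deriv_unique[OF \<eta> T _ _ v] by blast
  hence "AE t in lebesgue_on {0<..<T}. (weak_deriv T u t)\<^sup>2 = (v t)\<^sup>2"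
    by eventually_elim simp
  hence "(LINT t|lebesgue_on {0<..<T}. (weak_deriv T u t)\<^sup>2) = (LINT t|lebesgue_on {0<..<T}. (v t)\<^sup>2)"
    using w v by (intro integral_cong_AE) (auto simp: L2_space_def)
  thus ?thesis by (simp add: L2_norm_def)
qed

text \<open>Integration by parts: the fundamental theorem of calculus for F * \<phi>, whose boundary
  terms vanish with \<phi> at 0 and T.\<close>

lemma has_weak_deriv_of_has_real_derivative:
  assumes T: "T > 0"
    and F: "\<And>t. (F has_real_derivative G t) (at t)" and G: "continuous_on {0..T} G"
    and u: "\<And>t. t \<in> {0<..<T} \<Longrightarrow> u t = F t"
  shows "has_weak_deriv T u G"
  unfolding has_weak_deriv_def
proof (intro allI impI)
  fix \<phi> assume \<phi>: "test_function T \<phi>"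
  let ?M = "lebesgue_on {0<..<T}"
  have smooth: "smooth \<phi>" using \<phi> by (simp add: test_function_def)
  have \<phi>0: "\<phi> 0 = 0" "\<phi> T = 0"
    using \<phi> eq_0_outside_supp[of \<phi> "{0<..<T}"] by (auto simp: test_function_def)
  have contF: "continuous_on {0..T} F"
    using F by (meson DERIV_continuous_on has_field_derivative_at_within)
  \<comment> \<open>Identifies the Lebesgue integral over the open interval with the gauge integral
    over the closed one, in which the fundamental theorem is stated.\<close>
  have int: "integrable ?M h" "(LINT t|?M. h t) = integral {0..T} h"
    if h: "continuous_on {0..T} h" for h :: rfun
  proof -
    have "h absolutely_integrable_on {0..T}" by (rule absolutely_integrable_continuous_real[OF h])
    hence "h absolutely_integrable_on {0<..<T}" by (rule set_integrable_subset) auto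
    thus *: "integrable ?M h" by (simp add: set_integrable_def integrable_restrict_space)
    show "(LINT t|?M. h t) = integral {0..T} h"
      using lebesgue_integral_eq_integral[OF *] integral_open_interval_real[of 0 T h] by simp
  qed
  have c1: "continuous_on {0..T} (\<lambda>t. F t * deriv \<phi> t)"
    by (intro continuous_intros contF smooth_continuous_on smooth_deriv smooth)
  have c2: "continuous_on {0..T} (\<lambda>t. G t * \<phi> t)"
    by (intro continuous_intros G smooth_continuous_on smooth)
  have "((\<lambda>t. F t * deriv \<phi> t + G t * \<phi> t) has_integral F T * \<phi> T - F 0 * \<phi> 0) {0..T}"
  proof (rule fundamental_theorem_of_calculus)
    fix t
    have "((\<lambda>t. F t * \<phi> t) has_real_derivative F t * deriv \<phi> t + G t * \<phi> t) (at t within {0..T})"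
      by (rule has_field_derivative_at_within)
         (auto intro!: derivative_eq_intros F smooth_has_derivative[OF smooth])
    thus "((\<lambda>t. F t * \<phi> t) has_vector_derivative F t * deriv \<phi> t + G t * \<phi> t) (at t within {0..T})"
      by (simp add: has_real_derivative_iff_has_vector_derivative)
  qed (use T in simp)
  hence "integral {0..T} (\<lambda>t. F t * deriv \<phi> t + G t * \<phi> t) = 0"
    using \<phi>0 by (simp add: integral_unique)
  hence "(LINT t|?M. F t * deriv \<phi> t) + (LINT t|?M. G t * \<phi> t) = 0"
    using int[OF c1] int[OF c2]
    by (simp add: integral_add integrable_continuous_real[OF c1] integrable_continuous_real[OF c2])
  moreover have "(LINT t|?M. u t * deriv \<phi> t) = (LINT t|?M. F t * deriv \<phi> t)"
    by (intro Bochner_Integration.integral_cong) (auto simp: u)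
  ultimately show "(LINT t|?M. u t * deriv \<phi> t) = - (LINT t|?M. G t * \<phi> t)" by simp
qed

section \<open>Convolution with a smooth kernel of compact support\<close>

lemma convolve_integrable:
  assumes f: "smooth f" "\<And>x. \<bar>f x\<bar> \<le> b" and w: "integrable lebesgue w"
  shows "integrable lebesgue (\<lambda>s. f (t - s) * w s)"
proof (rule Bochner_Integration.integrable_bound[where f="\<lambda>s. b * w s"])
  show "integrable lebesgue (\<lambda>s. b * w s)" using w by simp
  have "continuous_on UNIV (\<lambda>s. f (t - s))"
    by (rule continuous_on_compose2[OF smooth_continuous_on[OF f(1), of UNIV]])
       (auto intro!: continuous_intros)
  hence "(\<lambda>s. f (t - s)) \<in> borel_measurable borel" by (rule borel_measurable_continuous_onI)
  hence "(\<lambda>s. f (t - s)) \<in> borel_measurable lebesgue" by (intro measurable_completion) simp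
  thus "(\<lambda>s. f (t - s) * w s) \<in> borel_measurable lebesgue"
    using w by (intro borel_measurable_times) auto
  have "\<bar>f (t - s) * w s\<bar> \<le> \<bar>b * w s\<bar>" for s
    using mult_left_mono[OF f(2)[of "t - s"], of "\<bar>w s\<bar>"] f(2)[of "t - s"]
    by (simp add: abs_mult mult.commute)
  thus "AE s in lebesgue. norm (f (t - s) * w s) \<le> norm (b * w s)" by simp
qed

lemma convolve_bound:
  assumes f: "smooth f" "\<And>x. \<bar>f x\<bar> \<le> b" and w: "integrable lebesgue w"
  shows "\<bar>convolve f w t\<bar> \<le> b * (LINT s|lebesgue. \<bar>w s\<bar>)"
proof -
  have "\<bar>convolve f w t\<bar> \<le> (LINT s|lebesgue. \<bar>f (t - s) * w s\<bar>)"
    unfolding convolve_def by (rule integral_abs_bound)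
  also have "\<dots> \<le> (LINT s|lebesgue. b * \<bar>w s\<bar>)"
  proof (rule integral_mono)
    show "integrable lebesgue (\<lambda>s. \<bar>f (t - s) * w s\<bar>)"
      using convolve_integrable[OF f w, of t] by (rule integrable_abs)
    show "\<bar>f (t - s) * w s\<bar> \<le> b * \<bar>w s\<bar>" for s
      using f(2) by (simp add: abs_mult mult_right_mono)
  qed (use w in simp)
  finally show ?thesis by simp
qed

text \<open>The remainder of the convolution is the integral of the Taylor remainder of f times w,
  hence at most b'' * h^2 times the L1 norm of w; dividing by h leaves O(h). The bounded support
  supplies bounds for f, f' and f''.\<close>

lemma convolve_has_real_derivative:
  assumes f: "smooth f" "\<And>x. R < \<bar>x\<bar> \<Longrightarrow> f x = 0" and w: "integrable lebesgue w"
  shows "(convolve f w has_real_derivative convolve (deriv f) w t) (at t)"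
proof -
  have out': "deriv f x = 0" if "R < \<bar>x\<bar>" for x by (rule deriv_eq_0_outside[OF f(2) that])
  have out'': "deriv (deriv f) x = 0" if "R < \<bar>x\<bar>" for x
    by (rule deriv_eq_0_outside[OF out' that])
  note smooth' = smooth_deriv[OF f(1)]
  obtain b where b: "\<And>x. \<bar>f x\<bar> \<le> b" using smooth_bounded[OF f] by blast
  obtain b' where b': "\<And>x. \<bar>deriv f x\<bar> \<le> b'" using smooth_bounded[OF smooth' out'] by blast
  obtain b'' where b'': "\<And>x. \<bar>deriv (deriv f) x\<bar> \<le> b''"
    using smooth_bounded[OF smooth_deriv[OF smooth'] out''] by blast
  let ?N = "LINT s|lebesgue. \<bar>w s\<bar>"
  have remainder: "\<bar>convolve f w (t + h) - convolve f w t - h * convolve (deriv f) w t\<bar>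
      \<le> b'' * h\<^sup>2 * ?N" for h
  proof -
    have i: "integrable lebesgue (\<lambda>s. f (t + h - s) * w s)" "integrable lebesgue (\<lambda>s. f (t - s) * w s)"
      "integrable lebesgue (\<lambda>s. deriv f (t - s) * w s)"
      using convolve_integrable[OF f(1) b w] convolve_integrable[OF smooth' b' w] by blast+
    let ?r = "\<lambda>s. f (t + h - s) * w s - f (t - s) * w s - h * (deriv f (t - s) * w s)"
    have eq: "convolve f w (t + h) - convolve f w t - h * convolve (deriv f) w t = (LINT s|lebesgue. ?r s)"
      unfolding convolve_def using i
      by (simp only: Bochner_Integration.integral_diff Bochner_Integration.integrable_diff
          integrable_mult_right integral_mult_right_zero)
    have "\<bar>LINT s|lebesgue. ?r s\<bar> \<le> (LINT s|lebesgue. \<bar>?r s\<bar>)" by (rule integral_abs_bound)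
    also have "\<dots> \<le> (LINT s|lebesgue. b'' * h\<^sup>2 * \<bar>w s\<bar>)"
    proof (rule integral_mono)
      show "integrable lebesgue (\<lambda>s. \<bar>?r s\<bar>)" using i by simp
      show "integrable lebesgue (\<lambda>s. b'' * h\<^sup>2 * \<bar>w s\<bar>)" using w by simp
      fix s
      have "?r s = (f ((t - s) + h) - f (t - s) - h * deriv f (t - s)) * w s"
        by (simp add: algebra_simps)
      thus "\<bar>?r s\<bar> \<le> b'' * h\<^sup>2 * \<bar>w s\<bar>"
        using first_order_remainder_bound[OF smooth_has_derivative[OF f(1)]
            smooth_has_derivative[OF smooth'] b'', of "t - s" h]
        by (simp add: abs_mult mult_right_mono)
    qed
    finally show ?thesis by (simp add: eq)
  qed
  let ?q = "\<lambda>h. (convolve f w (t + h) - convolve f w t) / h - convolve (deriv f) w t"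
  have "(\<lambda>h. ?q h) \<midarrow>0\<rightarrow> 0"
  proof (rule tendsto_rabs_zero_cancel, rule tendsto_sandwich)
    show "\<forall>\<^sub>F h in at 0. 0 \<le> \<bar>?q h\<bar>" by simp
    have "\<bar>?q h\<bar> \<le> b'' * ?N * \<bar>h\<bar>" if "h \<noteq> 0" for h
    proof -
      have "\<bar>?q h\<bar> * \<bar>h\<bar> = \<bar>convolve f w (t + h) - convolve f w t - h * convolve (deriv f) w t\<bar>"
      proof -
        have "?q h * h = convolve f w (t + h) - convolve f w t - h * convolve (deriv f) w t"
          using that by (simp add: left_diff_distrib[of "_ / _"])
        thus ?thesis by (metis abs_mult)
      qed
      also have "\<dots> \<le> (b'' * ?N * \<bar>h\<bar>) * \<bar>h\<bar>"
        using remainder[of h] by (simp add: power2_eq_square mult_ac)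
      finally show ?thesis using that by (simp add: mult_le_cancel_right)
    qed
    thus "\<forall>\<^sub>F h in at 0. \<bar>?q h\<bar> \<le> b'' * ?N * \<bar>h\<bar>"
      by (auto simp: eventually_at_filter)
    show "((\<lambda>h. b'' * ?N * \<bar>h\<bar>) \<longlongrightarrow> 0) (at 0)"
      by (auto intro!: tendsto_eq_intros)
  qed simp
  thus ?thesis unfolding DERIV_def by (rule LIM_zero_cancel)
qed

section \<open>The mollification operator\<close>

lemma mollifier_smooth:
  assumes "mollifier_kernel \<eta>"
  shows "smooth (mollifier \<eta> \<epsilon>)"
proof -
  have eq: "mollifier \<eta> \<epsilon> = (\<lambda>t. (1 / \<epsilon>) * \<eta> ((1 / \<epsilon>) * t + 0))"
    by (simp add: mollifier_def fun_eq_iff)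
  show ?thesis
    unfolding eq by (rule smooth_affine) (use assms in \<open>simp add: mollifier_kernel_def\<close>)
qed

lemma mollifier_eq_0_outside:
  assumes "mollifier_kernel \<eta>" "\<epsilon> > 0" "\<epsilon> < \<bar>x\<bar>"
  shows "mollifier \<eta> \<epsilon> x = 0"
proof -
  have "\<eta> (x / \<epsilon>) = 0"
  proof (rule eq_0_outside_supp[of \<eta> "{-1..1}"])
    have "1 < \<bar>x / \<epsilon>\<bar>" using assms by simp
    thus "x / \<epsilon> \<notin> {-1..1}" unfolding atLeastAtMost_iff by linarith
  qed (use assms in \<open>simp add: mollifier_kernel_def\<close>)
  thus ?thesis by (simp add: mollifier_def)
qed

text \<open>Reconciles the closed interval in \<open>cut\<close> with the open interval of the
  function spaces.\<close>

lemma cut_eq_AE: "AE t in lebesgue. cut T w t = indicator {0<..<T} t * w t"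
proof (rule AE_I')
  show "{0, T} \<in> null_sets lebesgue" by (simp add: null_sets_completionI finite_imp_null_set_lborel)
  show "{t \<in> space lebesgue. cut T w t \<noteq> indicator {0<..<T} t * w t} \<subseteq> {0, T}"
    by (auto simp: cut_def indicator_def)
qed

lemma cut_integrable:
  assumes "w \<in> L1_space T"
  shows "integrable lebesgue (cut T w)" and "(LINT t|lebesgue. \<bar>cut T w t\<bar>) = L1_norm T w"
proof -
  have int: "integrable lebesgue (\<lambda>t. indicator {0<..<T} t * w t)"
    using assms by (simp add: L1_space_def integrable_lebesgue_on_iff)
  \<comment> \<open>Lebesgue measure is complete, so measurability survives a change on a null
    set.\<close>
  have meas: "cut T w \<in> borel_measurable lebesgue"
  proof (rule borel_measurable_AE[OF borel_measurable_integrable[OF int]])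
    show "AE t in lebesgue. indicator {0<..<T} t * w t = cut T w t"
      using cut_eq_AE[of T w] by eventually_elim simp
  qed
  show "integrable lebesgue (cut T w)"
    using integrable_cong_AE_imp[OF int meas] cut_eq_AE[of T w] by (simp add: eq_commute)
  have "AE t in lebesgue. \<bar>cut T w t\<bar> = indicator {0<..<T} t * \<bar>w t\<bar>"
    using cut_eq_AE[of T w] by eventually_elim (simp add: abs_mult)
  hence "(LINT t|lebesgue. \<bar>cut T w t\<bar>) = (LINT t|lebesgue. indicator {0<..<T} t * \<bar>w t\<bar>)"
  proof (rule integral_cong_AE[rotated 2])
    have "integrable lebesgue (\<lambda>t. \<bar>indicator {0<..<T} t * w t\<bar>)" using int by simp
    thus "(\<lambda>t. indicator {0<..<T} t * \<bar>w t\<bar>) \<in> borel_measurable lebesgue"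
      by (simp add: abs_mult)
  qed (use meas in simp)
  thus "(LINT t|lebesgue. \<bar>cut T w t\<bar>) = L1_norm T w"
    by (simp add: L1_norm_def integral_lebesgue_on_eq)
qed

text \<open>The chain rule asks for equality of functions, not merely up to seminorm 0. Membership
  in L1 makes both convolution integrands integrable, which is why the integral splits at every
  t.\<close>

lemma K_op_add:
  assumes \<eta>: "mollifier_kernel \<eta>" "\<epsilon> > 0" and u: "u \<in> L1_space T" and v: "v \<in> L1_space T"
  shows "K_op \<eta> \<epsilon> T (\<lambda>s. u s + v s) = (\<lambda>t. K_op \<eta> \<epsilon> T u t + K_op \<eta> \<epsilon> T v t)"
proof -
  note smooth = mollifier_smooth[OF \<eta>(1)]
  obtain b where b: "\<And>x. \<bar>mollifier \<eta> \<epsilon> x\<bar> \<le> b"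
    using smooth_bounded[OF smooth mollifier_eq_0_outside[OF \<eta>]] by blast
  have "convolve (mollifier \<eta> \<epsilon>) (cut T (\<lambda>s. u s + v s)) t
      = convolve (mollifier \<eta> \<epsilon>) (cut T u) t + convolve (mollifier \<eta> \<epsilon>) (cut T v) t" for t
  proof -
    have cut: "cut T (\<lambda>s. u s + v s) s = cut T u s + cut T v s" for s by (simp add: cut_def)
    show ?thesis
      using convolve_integrable[OF smooth b cut_integrable(1)[OF u], of t]
        convolve_integrable[OF smooth b cut_integrable(1)[OF v], of t]
      by (simp add: convolve_def cut distrib_left)
  qed
  thus ?thesis by (simp add: K_op_def fun_eq_iff cut_def)
qed

lemma K_op_scale: "K_op \<eta> \<epsilon> T (\<lambda>s. c * u s) = (\<lambda>t. c * K_op \<eta> \<epsilon> T u t)"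
proof -
  have cut: "cut T (\<lambda>s. c * u s) s = c * cut T u s" for s by (simp add: cut_def)
  have "convolve (mollifier \<eta> \<epsilon>) (cut T (\<lambda>s. c * u s)) t
      = convolve (mollifier \<eta> \<epsilon>) (cut T u) t * c" for t
    unfolding convolve_def cut by (simp add: mult.left_commute mult.commute[of _ c])
  thus ?thesis by (simp add: K_op_def fun_eq_iff cut_def)
qed

text \<open>The convolutions with the mollifier and with its derivative are bounded by b and b'
  times the L1 norm of w; passing from a sup bound to L2 gives the factor sqrt T. The dependence on
  \<epsilon> enters through b and b'.\<close>

lemma K_op_H1:
  assumes \<eta>: "mollifier_kernel \<eta>" "\<epsilon> > 0" and T: "T > 0"
  obtains B where "B > 0" "\<And>w. w \<in> L1_space T \<Longrightarrow> K_op \<eta> \<epsilon> T w \<in> H1_space T"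
    "\<And>w. w \<in> L1_space T \<Longrightarrow> H1_norm T (K_op \<eta> \<epsilon> T w) \<le> B * L1_norm T w"
proof -
  let ?f = "mollifier \<eta> \<epsilon>"
  note smooth = mollifier_smooth[OF \<eta>(1), of \<epsilon>] and out = mollifier_eq_0_outside[OF \<eta>]
  note smooth' = smooth_deriv[OF smooth]
  have out': "deriv ?f x = 0" if "\<epsilon> < \<bar>x\<bar>" for x
    by (rule deriv_eq_0_outside[OF out that])
  obtain b where b: "b > 0" "\<And>x. \<bar>?f x\<bar> \<le> b"
    using smooth_bounded[OF smooth out] by blast
  obtain b' where b': "b' > 0" "\<And>x. \<bar>deriv ?f x\<bar> \<le> b'"
    using smooth_bounded[OF smooth' out'] by blast
  have main: "K_op \<eta> \<epsilon> T w \<in> H1_space T \<and>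
      H1_norm T (K_op \<eta> \<epsilon> T w) \<le> sqrt T * (b + b') * L1_norm T w" if w: "w \<in> L1_space T" for w
  proof -
    let ?F = "convolve ?f (cut T w)" and ?G = "convolve (deriv ?f) (cut T w)"
    let ?u = "K_op \<eta> \<epsilon> T w" and ?n = "L1_norm T w"
    note int = cut_integrable(1)[OF w]
    have n: "?n \<ge> 0" by (simp add: L1_norm_def)
    have F: "(?F has_real_derivative ?G t) (at t)" for t
      by (rule convolve_has_real_derivative[OF smooth out int])
    \<comment> \<open>Differentiability of the derivative supplies the continuity that integration
      by parts and measurability require.\<close>
    have G: "(?G has_real_derivative convolve (deriv (deriv ?f)) (cut T w) t) (at t)" for t
      by (rule convolve_has_real_derivative[OF smooth' out' int])
    have cont: "continuous_on S ?F" "continuous_on S ?G" for S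
      using F G by (meson DERIV_continuous_on has_field_derivative_at_within)+
    have meas: "?F \<in> borel_measurable borel" "?G \<in> borel_measurable borel"
      by (intro borel_measurable_continuous_onI cont)+
    have u: "?u t = ?F t" if "t \<in> {0<..<T}" for t
      using that by (simp add: K_op_def cut_def)
    have Fb: "\<bar>?F t\<bar> \<le> b * ?n" and Gb: "\<bar>?G t\<bar> \<le> b' * ?n" for t
      using convolve_bound[OF smooth b(2) int] convolve_bound[OF smooth' b'(2) int]
        cut_integrable(2)[OF w] by simp_all
    note uL2 = bounded_mem_L2_space[OF T meas(1) Fb u]
    have GL2: "?G \<in> L2_space T" "L2_norm T ?G \<le> sqrt T * (b' * ?n)"
      by (rule bounded_mem_L2_space[OF T meas(2) Gb], simp)+
    have weak: "has_weak_deriv T ?u ?G"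
      by (rule has_weak_deriv_of_has_real_derivative[OF T F cont(2) u])
    have "H1_norm T ?u = sqrt ((L2_norm T ?u)\<^sup>2 + (L2_norm T ?G)\<^sup>2)"
      by (simp add: H1_norm_def weak_deriv_L2_norm[OF \<eta>(1) T GL2(1) weak])
    also have "\<dots> \<le> L2_norm T ?u + L2_norm T ?G"
      by (rule sqrt_sum_squares_le_sum) (rule L2_norm_nonneg)+
    also have "\<dots> \<le> sqrt T * (b + b') * ?n"
      using uL2(2) GL2(2) by (simp add: algebra_simps)
    finally show ?thesis using uL2(1) GL2(1) weak by (auto simp: H1_space_def)
  qed
  show thesis
    by (rule that[of "sqrt T * (b + b')"]) (use main b(1) b'(1) T in auto)
qed

text \<open>K is exactly linear, so the defects in \<open>bounded_linear_op\<close> are the zero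
  function; its chosen weak derivative is only known to vanish almost everywhere.\<close>

lemma H1_norm_zero:
  assumes \<eta>: "mollifier_kernel \<eta>" and T: "T > 0"
  shows "H1_norm T (\<lambda>t. 0) = 0"
proof -
  have "L2_norm T (weak_deriv T (\<lambda>t. 0)) = L2_norm T (\<lambda>t. 0)"
    by (rule weak_deriv_L2_norm[OF \<eta> T]) (simp_all add: L2_space_def has_weak_deriv_def)
  thus ?thesis by (simp add: H1_norm_def L2_norm_def)
qed

theorem proposition4p6:
  fixes T \<epsilon> :: real and \<eta> :: "real \<Rightarrow> real"
  assumes "T > 0" and "\<epsilon> > 0" and "mollifier_kernel \<eta>"
  shows "bounded_linear_op (L1_space T) (L1_norm T) (H1_space T) (H1_norm T) (K_op \<eta> \<epsilon> T) \<and>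
    (\<forall>j :: (real \<Rightarrow> real) \<Rightarrow> real.
       twice_frechet_differentiable (H1_space T) (H1_norm T) j \<and>
       (\<exists>C>0. \<forall>w\<in>H1_space T. \<forall>\<psi>\<in>H1_space T. \<forall>\<phi>\<in>H1_space T.
          \<bar>hess (H1_space T) (H1_norm T) j w \<psi> \<phi>\<bar> \<le> C * H1_norm T \<psi> * H1_norm T \<phi>)
       \<longrightarrow>
       twice_frechet_differentiable (L2_space T) (L2_norm T) (j \<circ> K_op \<eta> \<epsilon> T) \<and>
       (\<exists>C\<epsilon>>0. \<forall>w\<in>L2_space T. \<forall>\<psi>\<in>L2_space T. \<forall>\<phi>\<in>L2_space T.
          \<bar>hess (L2_space T) (L2_norm T) (j \<circ> K_op \<eta> \<epsilon> T) w \<psi> \<phi>\<bar>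
            \<le> C\<epsilon> * L1_norm T \<psi> * L1_norm T \<phi>))"
proof -
  let ?K = "K_op \<eta> \<epsilon> T"
  note T = assms(1) and \<eta> = assms(3,2)
  obtain B where B: "B > 0" "\<And>w. w \<in> L1_space T \<Longrightarrow> ?K w \<in> H1_space T"
    "\<And>w. w \<in> L1_space T \<Longrightarrow> H1_norm T (?K w) \<le> B * L1_norm T w"
    using K_op_H1[OF \<eta> T] by blast
  have "bounded_linear_op (L1_space T) (L1_norm T) (H1_space T) (H1_norm T) ?K"
    unfolding bounded_linear_op_def
    using B K_op_add[OF \<eta>] H1_norm_zero[OF \<eta>(1) T] by (auto simp: K_op_scale)
  moreover have "twice_frechet_differentiable (L2_space T) (L2_norm T) (j \<circ> ?K) \<and>
      (\<exists>C\<epsilon>>0. \<forall>w\<in>L2_space T. \<forall>\<psi>\<in>L2_space T. \<forall>\<phi>\<in>L2_space T.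
        \<bar>hess (L2_space T) (L2_norm T) (j \<circ> ?K) w \<psi> \<phi>\<bar> \<le> C\<epsilon> * L1_norm T \<psi> * L1_norm T \<phi>)"
    if j: "twice_frechet_differentiable (H1_space T) (H1_norm T) j"
      and C: "C > 0" "\<And>w \<psi> \<phi>. w \<in> H1_space T \<Longrightarrow> \<psi> \<in> H1_space T \<Longrightarrow> \<phi> \<in> H1_space T \<Longrightarrow>
        \<bar>hess (H1_space T) (H1_norm T) j w \<psi> \<phi>\<bar> \<le> C * H1_norm T \<psi> * H1_norm T \<phi>" for j C
  proof -
    have L1: "u \<in> L1_space T" if "u \<in> L2_space T" for u
      using that L2_space_subset_L1_space by blast
    have H1: "?K u \<in> H1_space T" if "u \<in> L2_space T" for u by (rule B(2)[OF L1[OF that]])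
    have add: "?K (\<lambda>s. u s + v s) = (\<lambda>s. ?K u s + ?K v s)"
      if "u \<in> L2_space T" "v \<in> L2_space T" for u v
      by (rule K_op_add[OF \<eta> L1[OF that(1)] L1[OF that(2)]])
    have homog: "?K (\<lambda>s. c * u s) = (\<lambda>s. c * ?K u s)"
      and norm_scale: "L2_norm T (\<lambda>s. c * u s) = \<bar>c\<bar> * L2_norm T u"
      if "u \<in> L2_space T" for c u
      by (rule K_op_scale L2_norm_scale)+
    have bound: "H1_norm T (?K u) \<le> (B * sqrt T) * L2_norm T u" if "u \<in> L2_space T" for u
    proof -
      have "H1_norm T (?K u) \<le> B * L1_norm T u" by (rule B(3)[OF L1[OF that]])
      also have "\<dots> \<le> B * (sqrt T * L2_norm T u)"
        using L1_norm_le_L2_norm[OF T that] B(1) by (intro mult_left_mono) auto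
      finally show ?thesis by (simp add: mult_ac)
    qed
    have pos: "B * sqrt T > 0" using B(1) T by simp
    have H1_nonneg: "0 \<le> H1_norm T u" for u by (simp add: H1_norm_def)
    note chain = twice_frechet_differentiable_compose_linear
      [where V="L2_space T" and N="L2_norm T" and W="H1_space T" and M="H1_norm T" and K="?K",
        OF H1 add homog pos bound H1_nonneg L2_space_add L2_space_scale norm_scale L2_norm_nonneg j]
    have diff: "twice_frechet_differentiable (L2_space T) (L2_norm T) (j \<circ> ?K)"
      by (rule chain(1))
    have hess: "hess (L2_space T) (L2_norm T) (j \<circ> ?K) w \<psi> \<phi>
        = hess (H1_space T) (H1_norm T) j (?K w) (?K \<psi>) (?K \<phi>)"
      if "w \<in> L2_space T" "\<psi> \<in> L2_space T" "\<phi> \<in> L2_space T" for w \<psi> \<phi>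
      by (rule chain(2)) (use that in blast)+
    \<comment> \<open>The formula for the Hessian involves \<psi> and \<phi> only through K, so each
      factor is estimated by \<open>B(3)\<close> in the L1 norm instead of by
      \<open>bound\<close>.\<close>
    have "\<bar>hess (L2_space T) (L2_norm T) (j \<circ> ?K) w \<psi> \<phi>\<bar>
        \<le> (C * B * B) * L1_norm T \<psi> * L1_norm T \<phi>"
      if "w \<in> L2_space T" "\<psi> \<in> L2_space T" "\<phi> \<in> L2_space T" for w \<psi> \<phi>
    proof -
      have "\<bar>hess (L2_space T) (L2_norm T) (j \<circ> ?K) w \<psi> \<phi>\<bar>
          \<le> C * H1_norm T (?K \<psi>) * H1_norm T (?K \<phi>)"
        unfolding hess[OF that] by (intro C(2) H1 that)
      also have "\<dots> \<le> C * (B * L1_norm T \<psi>) * (B * L1_norm T \<phi>)"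
        using B(3)[OF L1] that C(1) B(1) H1_nonneg
        by (intro mult_mono mult_nonneg_nonneg) (auto simp: L1_norm_def)
      finally show ?thesis by (simp add: mult_ac)
    qed
    moreover have "C * B * B > 0" using C(1) B(1) by simp
    ultimately show ?thesis using diff by blast
  qed
  ultimately show ?thesis by blast
qed

end
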